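(* Every cominuscule parabolic set $P$ of roots of $\mathfrak{sl}(m|n)$, $m\neq n$, is conjugate under the action of the Weyl group $W_{\mathfrak{sl}(m)}\times W_{\mathfrak{sl}(n)}$ of $\mathfrak{g}_{\bar0}$ to a unique subset of the form $P_{\mathfrak{sl}(m|n)}(m_0|n_0)$ for some $m_0,n_0$ such that $0\le m_0\le m$, $0\le n_0\le n$ and $(m_0,n_0)\ne(0,0),(m,n)$. For the Levi subalgebras $\mathfrak{l}$ and nilradicals $\mathfrak{n}^+$ of the corresponding parabolic subalgebras, \[ \mathfrak{l}\cong\mathfrak{sl}(m_0|n_0)\oplus\mathfrak{sl}(m-m_0|n-n_0)\oplus\mathbb{C} \] and, as an $\mathfrak{l}$-module, $\mathfrak{n}^+\cong V^{m_0|n_0}\otimes\bigl(V^{m-m_0|n-n_0}\bigr)^*$.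
   Context: $\mathfrak{g}=\mathfrak{sl}(m|n)$ with diagonal Cartan subalgebra $\mathfrak{h}$; $\mathfrak{g}_{\bar0}\cong\mathfrak{sl}(m)\oplus\mathfrak{sl}(n)\oplus\mathbb{C}$; root system $\Delta=\{\varepsilon_i-\varepsilon_j,\ \delta_k-\delta_l\mid i\ne j,\ k\ne l\}\sqcup\{\pm(\varepsilon_i-\delta_l)\}$, $1\le i,j\le m$, $1\le k,l\le n$. The Weyl group acts by permuting the $\varepsilon_i$ and the $\delta_k$ separately. A proper subset $P\subsetneq\Delta$ is parabolic if $\Delta=P\cup(-P)$ and ($\alpha,\beta\in P$, $\alpha+\beta\in\Delta$ imply $\alpha+\beta\in P$). Its Levi component is $L=P\cap(-P)$ and its nilradical is $N^+=P\setminus(-P)$. The parabolic subalgebra is $\mathfrak{p}_P=\mathfrak{h}\oplus\bigoplus_{\alpha\in P}\mathfrak{g}^\alpha$, with Levi subalgebra $\mathfrak{l}=\mathfrak{h}\oplus\bigoplus_{\alpha\in L}\mathfrak{g}^\alpha$ and nilradical $\mathfrak{n}^+=\bigoplus_{\alpha\in N^+}\mathfrak{g}^\alpha$. $P$ is cominuscule if $\mathfrak{n}^+$ is abelian. $P_{\mathfrak{sl}(m|n)}(m_0|n_0)=L(m_0|n_0)\sqcup N^+(m_0|n_0)$, where $L(m_0|n_0)$ consists of the roots $\varepsilon_i-\varepsilon_j$ with $i\neq j$ both $\le m_0$ or both $>m_0$; $\delta_k-\delta_l$ with $k\ne l$ both $\le n_0$ or both $>n_0$; $\pm(\varepsilon_i-\delta_l)$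 with ($i\le m_0$ and $l\le n_0$) or ($i>m_0$ and $l>n_0$); and $N^+(m_0|n_0)$ consists of the roots $\varepsilon_i-\varepsilon_j$, $\delta_k-\delta_l$, $\varepsilon_i-\delta_l$, $\delta_k-\varepsilon_j$ with $i\le m_0<j$, $k\le n_0<l$ (each index condition imposed only for the indices that occur). $V^{p|q}$ is the standard representation of $\mathfrak{gl}(p|q)$; the same notation is used for its restrictions to subalgebras.
   Formalization: The direct-sum isomorphism for the Levi subalgebra is claimed only when m0≠n0 and m−m0≠n−n0, since it is false otherwise (e.g. m=2, n=1, m0=n0=1, where the Levi is gl(1|1)); in every case it is shown to be a semidirect sum of the ideal sl(m0|n0)⊕sl(m−m0|n−n0) and C. *)

theory Defs
  imports
    Complex_Main
    "HOL-Combinatorics.Permutations"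
    "HOL-Library.Function_Algebras"
    "HOL-Library.Product_Plus"
begin

section \<open>Lie superalgebras and their modules\<close>

text \<open>
  All vector spaces are over the complex numbers. Addition comes from the type of the elements
  (pointwise on functions, componentwise on pairs); the scalar multiplication is a record field.
  The fields \<open>even\<close> and \<open>odd\<close> may be larger than the two homogeneous parts of the space, which are
  their intersections with the space; so passing to a graded subspace only changes the space.
\<close>

record 'a lie_superalgebra =
  lspace :: "'a set"
  even_part :: "'a set"
  odd_part :: "'a set"
  lscale :: "complex \<Rightarrow> 'a \<Rightarrow> 'a"
  bracket :: "'a \<Rightarrow> 'a \<Rightarrow> 'a"

definition lsa_restrict :: "'a lie_superalgebra \<Rightarrow> 'a set \<Rightarrow> 'a lie_superalgebra" where
  "lsa_restrict L S = L\<lparr>lspace := S\<rparr>"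

definition lsa_iso ::
  "('a::ab_group_add) lie_superalgebra \<Rightarrow> ('b::ab_group_add) lie_superalgebra \<Rightarrow> ('a \<Rightarrow> 'b) \<Rightarrow> bool"
where
  "lsa_iso L M \<phi> \<longleftrightarrow>
     bij_betw \<phi> (lspace L) (lspace M) \<and>
     (\<forall>x\<in>lspace L. \<forall>y\<in>lspace L. \<phi> (x + y) = \<phi> x + \<phi> y) \<and>
     (\<forall>c. \<forall>x\<in>lspace L. \<phi> (lscale L c x) = lscale M c (\<phi> x)) \<and>
     (\<forall>x\<in>lspace L. (\<phi> x \<in> even_part M \<longleftrightarrow> x \<in> even_part L) \<and>
                   (\<phi> x \<in> odd_part M \<longleftrightarrow> x \<in> odd_part L)) \<and>
     (\<forall>x\<in>lspace L. \<forall>y\<in>lspace L. \<phi> (bracket L x y) = bracket M (\<phi> x) (\<phi> y))"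

definition lsa_isomorphic ::
  "('a::ab_group_add) lie_superalgebra \<Rightarrow> ('b::ab_group_add) lie_superalgebra \<Rightarrow> bool" where
  "lsa_isomorphic L M \<longleftrightarrow> (\<exists>\<phi>. lsa_iso L M \<phi>)"

definition lsa_sum ::
  "'a lie_superalgebra \<Rightarrow> 'b lie_superalgebra \<Rightarrow> ('a \<times> 'b) lie_superalgebra" where
  "lsa_sum L M =
     \<lparr>lspace = lspace L \<times> lspace M,
      even_part = even_part L \<times> even_part M,
      odd_part = odd_part L \<times> odd_part M,
      lscale = (\<lambda>c (x, y). (lscale L c x, lscale M c y)),
      bracket = (\<lambda>(x, y) (x', y'). (bracket L x x', bracket M y y'))\<rparr>"

text \<open>The one-dimensional, purely even, abelian Lie superalgebra.\<close>

definition lsa_C :: "complex lie_superalgebra" where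
  "lsa_C = \<lparr>lspace = UNIV, even_part = UNIV, odd_part = {0}, lscale = (*), bracket = (\<lambda>_ _. 0)\<rparr>"

definition lsa_subspace :: "('a::ab_group_add) lie_superalgebra \<Rightarrow> 'a set \<Rightarrow> bool" where
  "lsa_subspace L S \<longleftrightarrow>
     S \<subseteq> lspace L \<and> 0 \<in> S \<and> (\<forall>x\<in>S. \<forall>y\<in>S. x + y \<in> S) \<and> (\<forall>c. \<forall>x\<in>S. lscale L c x \<in> S) \<and>
     (\<forall>x\<in>S. \<exists>y\<in>S \<inter> even_part L. \<exists>z\<in>S \<inter> odd_part L. x = y + z)"

definition lsa_subalgebra :: "('a::ab_group_add) lie_superalgebra \<Rightarrow> 'a set \<Rightarrow> bool" where
  "lsa_subalgebra L S \<longleftrightarrow> lsa_subspace L S \<and> (\<forall>x\<in>S. \<forall>y\<in>S. bracket L x y \<in> S)"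

definition lsa_ideal :: "('a::ab_group_add) lie_superalgebra \<Rightarrow> 'a set \<Rightarrow> bool" where
  "lsa_ideal L S \<longleftrightarrow>
     lsa_subspace L S \<and> (\<forall>x\<in>lspace L. \<forall>y\<in>S. bracket L x y \<in> S \<and> bracket L y x \<in> S)"

text \<open>
  The Levi subalgebra for (m0|n0) always contains sl(m0|n0) + sl(m - m0|n - n0) as an ideal with a
  one-dimensional even complement. The complement can be chosen central, giving a direct sum of
  Lie superalgebras, only if neither block has equally many even and odd indices: otherwise the
  (one-dimensional) centre is spanned by the identity of such a block and lies in the ideal.
\<close>

definition semidirect_sum ::
  "('a::ab_group_add) lie_superalgebra \<Rightarrow> 'a set \<Rightarrow> 'a set \<Rightarrow> bool" where
  "semidirect_sum L S T \<longleftrightarrow>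
     lsa_ideal L S \<and> lsa_subalgebra L T \<and> S \<inter> T = {0} \<and>
     lspace L = {s + t | s t. s \<in> S \<and> t \<in> T}"

record ('l, 'v) super_module =
  mspace :: "'v set"
  meven :: "'v set"
  modd :: "'v set"
  mscale :: "complex \<Rightarrow> 'v \<Rightarrow> 'v"
  act :: "'l \<Rightarrow> 'v \<Rightarrow> 'v"

definition module_iso ::
  "'l lie_superalgebra \<Rightarrow> ('l, 'v::ab_group_add) super_module \<Rightarrow>
   ('l, 'w::ab_group_add) super_module \<Rightarrow> ('v \<Rightarrow> 'w) \<Rightarrow> bool" where
  "module_iso L M N \<phi> \<longleftrightarrow>
     bij_betw \<phi> (mspace M) (mspace N) \<and>
     (\<forall>u\<in>mspace M. \<forall>v\<in>mspace M. \<phi> (u + v) = \<phi> u + \<phi> v) \<and>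
     (\<forall>c. \<forall>v\<in>mspace M. \<phi> (mscale M c v) = mscale N c (\<phi> v)) \<and>
     (\<forall>v\<in>mspace M. (\<phi> v \<in> meven N \<longleftrightarrow> v \<in> meven M) \<and> (\<phi> v \<in> modd N \<longleftrightarrow> v \<in> modd M)) \<and>
     (\<forall>x\<in>lspace L. \<forall>v\<in>mspace M. \<phi> (act M x v) = act N x (\<phi> v))"

definition module_isomorphic ::
  "'l lie_superalgebra \<Rightarrow> ('l, 'v::ab_group_add) super_module \<Rightarrow>
   ('l, 'w::ab_group_add) super_module \<Rightarrow> bool" where
  "module_isomorphic L M N \<longleftrightarrow> (\<exists>\<phi>. module_iso L M N \<phi>)"

text \<open>
  A finite-dimensional representation with a chosen homogeneous basis \<open>(e\<^sub>j)\<close>, \<open>j\<close> in \<open>rindex\<close>, where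
  \<open>e\<^sub>j\<close> has parity \<open>rparity j\<close> and \<open>x e\<^sub>b = (\<Sum>a. rmat x a b e\<^sub>a)\<close>. Since representations preserve the
  grading, the coefficient \<open>rmat x a b\<close> only sees the component of \<open>x\<close> of parity
  \<open>rparity a + rparity b\<close>, which makes the sign rule explicit also for inhomogeneous \<open>x\<close>.
\<close>

record ('l, 'j) super_rep =
  rindex :: "'j set"
  rparity :: "'j \<Rightarrow> nat"
  rmat :: "'l \<Rightarrow> 'j \<Rightarrow> 'j \<Rightarrow> complex"

definition rep_module :: "('l, 'j) super_rep \<Rightarrow> ('l, 'j \<Rightarrow> complex) super_module" where
  "rep_module R =
     \<lparr>mspace = {v. \<forall>a. v a \<noteq> 0 \<longrightarrow> a \<in> rindex R},
      meven = {v. \<forall>a. v a \<noteq> 0 \<longrightarrow> even (rparity R a)},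
      modd = {v. \<forall>a. v a \<noteq> 0 \<longrightarrow> odd (rparity R a)},
      mscale = (\<lambda>c v a. c * v a),
      act = (\<lambda>x v a. if a \<in> rindex R then \<Sum>b\<in>rindex R. rmat R x a b * v b else 0)\<rparr>"

definition rep_pullback :: "('k \<Rightarrow> 'l) \<Rightarrow> ('l, 'j) super_rep \<Rightarrow> ('k, 'j) super_rep" where
  "rep_pullback f R = \<lparr>rindex = rindex R, rparity = rparity R, rmat = (\<lambda>x. rmat R (f x))\<rparr>"

text \<open>
  In the dual basis, from \<open>(x f)(v) = - (-1)^(|x| |f|) f(x v)\<close>; the basis functional with index \<open>b\<close>
  has the parity of \<open>b\<close>.
\<close>

definition rep_dual :: "('l, 'j) super_rep \<Rightarrow> ('l, 'j) super_rep" where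
  "rep_dual R =
     \<lparr>rindex = rindex R, rparity = rparity R,
      rmat = (\<lambda>x a b. - ((-1) ^ ((rparity R a + rparity R b) * rparity R b)) * rmat R x b a)\<rparr>"

text \<open>
  In the basis of the \<open>e\<^sub>c \<otimes> e\<^sub>d\<close>, from \<open>x (v \<otimes> w) = x v \<otimes> w + (-1)^(|x| |v|) v \<otimes> x w\<close>.
\<close>

definition rep_tensor ::
  "('l, 'i) super_rep \<Rightarrow> ('l, 'j) super_rep \<Rightarrow> ('l, 'i \<times> 'j) super_rep" where
  "rep_tensor R S =
     \<lparr>rindex = rindex R \<times> rindex S,
      rparity = (\<lambda>(a, b). rparity R a + rparity S b),
      rmat = (\<lambda>x (a, b) (c, d).
        (if b = d then rmat R x a c else 0) +
        (if a = c then (-1) ^ ((rparity S b + rparity S d) * rparity R c) * rmat S x b d else 0))\<rparr>"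

section \<open>The Lie superalgebras gl(m|n) and sl(m|n)\<close>

text \<open>
  Rows and columns are indexed by \<open>Inl i\<close>, \<open>1 \<le> i \<le> m\<close> (even) and \<open>Inr k\<close>, \<open>1 \<le> k \<le> n\<close> (odd);
  matrices vanish outside this range.
\<close>

type_synonym idx = "nat + nat"
type_synonym smat = "idx \<Rightarrow> idx \<Rightarrow> complex"

definition idx_set :: "nat \<Rightarrow> nat \<Rightarrow> idx set" where
  "idx_set m n = {1..m} <+> {1..n}"

definition par :: "idx \<Rightarrow> nat" where
  "par a = (case a of Inl _ \<Rightarrow> 0 | Inr _ \<Rightarrow> 1)"

definition mat_scale :: "complex \<Rightarrow> smat \<Rightarrow> smat" where
  "mat_scale c A = (\<lambda>a b. c * A a b)"

definition mat_mult :: "nat \<Rightarrow> nat \<Rightarrow> smat \<Rightarrow> smat \<Rightarrow> smat" where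
  "mat_mult m n A B = (\<lambda>a b. \<Sum>c\<in>idx_set m n. A a c * B c b)"

definition homogeneous_mat :: "nat \<Rightarrow> smat \<Rightarrow> bool" where
  "homogeneous_mat p A \<longleftrightarrow> (\<forall>a b. A a b \<noteq> 0 \<longrightarrow> (even (par a + par b) \<longleftrightarrow> even p))"

text \<open>
  The bilinear extension of \<open>A B - (-1)^(|A| |B|) B A\<close>; see the lemma below.
\<close>

definition sbracket :: "nat \<Rightarrow> nat \<Rightarrow> smat \<Rightarrow> smat \<Rightarrow> smat" where
  "sbracket m n A B = (\<lambda>a b. \<Sum>c\<in>idx_set m n.
     A a c * B c b - (-1) ^ ((par a + par c) * (par c + par b)) * (B a c * A c b))"

lemma sbracket_homogeneous:
  assumes "homogeneous_mat p A" "homogeneous_mat q B"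
  shows "sbracket m n A B = mat_mult m n A B - mat_scale ((-1) ^ (p * q)) (mat_mult m n B A)"
proof (intro ext)
  fix a b
  have key: "(-1) ^ ((par a + par c) * (par c + par b)) * (B a c * A c b)
      = (-1) ^ (p * q) * (B a c * A c b)" for c
  proof (cases "B a c = 0 \<or> A c b = 0")
    case False
    then have "even ((par a + par c) * (par c + par b)) \<longleftrightarrow> even (p * q)"
      using assms unfolding homogeneous_mat_def by (metis even_mult_iff)
    then show ?thesis by (simp add: minus_one_power_iff)
  qed auto
  show "sbracket m n A B a b
      = (mat_mult m n A B - mat_scale ((-1) ^ (p * q)) (mat_mult m n B A)) a b"
    by (simp only: sbracket_def mat_mult_def mat_scale_def fun_diff_def sum_subtractf
        sum_distrib_left key)
qed

definition supertrace :: "nat \<Rightarrow> nat \<Rightarrow> smat \<Rightarrow> complex" where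
  "supertrace m n A = (\<Sum>i=1..m. A (Inl i) (Inl i)) - (\<Sum>k=1..n. A (Inr k) (Inr k))"

definition gl :: "nat \<Rightarrow> nat \<Rightarrow> smat lie_superalgebra" where
  "gl m n =
     \<lparr>lspace = {A. \<forall>a b. A a b \<noteq> 0 \<longrightarrow> a \<in> idx_set m n \<and> b \<in> idx_set m n},
      even_part = {A. homogeneous_mat 0 A},
      odd_part = {A. homogeneous_mat 1 A},
      lscale = mat_scale,
      bracket = sbracket m n\<rparr>"

definition sl :: "nat \<Rightarrow> nat \<Rightarrow> smat lie_superalgebra" where
  "sl m n = lsa_restrict (gl m n) {A \<in> lspace (gl m n). supertrace m n A = 0}"

text \<open>The standard representation \<open>V\<close> of gl(p|q).\<close>

definition std_rep :: "nat \<Rightarrow> nat \<Rightarrow> (smat, idx) super_rep" where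
  "std_rep p q = \<lparr>rindex = idx_set p q, rparity = par, rmat = (\<lambda>A. A)\<rparr>"

section \<open>Roots, parabolic sets and the Weyl group\<close>

definition cartan :: "nat \<Rightarrow> nat \<Rightarrow> smat set" where
  "cartan m n = {H \<in> lspace (sl m n). \<forall>a b. a \<noteq> b \<longrightarrow> H a b = 0}"

text \<open>
  Linear functionals on the Cartan subalgebra are extended by 0 to all matrices, so that equality
  and sums of functionals are those of functions.
\<close>

type_synonym weight = "smat \<Rightarrow> complex"

definition eps :: "nat \<Rightarrow> nat \<Rightarrow> nat \<Rightarrow> weight" where
  "eps m n i = (\<lambda>H. if H \<in> cartan m n then H (Inl i) (Inl i) else 0)"

definition del :: "nat \<Rightarrow> nat \<Rightarrow> nat \<Rightarrow> weight" where
  "del m n k = (\<lambda>H. if H \<in> cartan m n then H (Inr k) (Inr k) else 0)"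

definition roots :: "nat \<Rightarrow> nat \<Rightarrow> weight set" where
  "roots m n =
     {eps m n i - eps m n j | i j. i \<in> {1..m} \<and> j \<in> {1..m} \<and> i \<noteq> j} \<union>
     {del m n k - del m n l | k l. k \<in> {1..n} \<and> l \<in> {1..n} \<and> k \<noteq> l} \<union>
     {eps m n i - del m n l | i l. i \<in> {1..m} \<and> l \<in> {1..n}} \<union>
     {del m n l - eps m n i | i l. i \<in> {1..m} \<and> l \<in> {1..n}}"

definition root_space :: "nat \<Rightarrow> nat \<Rightarrow> weight \<Rightarrow> smat set" where
  "root_space m n \<alpha> =
     {X \<in> lspace (sl m n). \<forall>H\<in>cartan m n. sbracket m n H X = mat_scale (\<alpha> H) X}"

definition root_space_sum :: "nat \<Rightarrow> nat \<Rightarrow> weight set \<Rightarrow> smat set" where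
  "root_space_sum m n S = {\<Sum>\<alpha>\<in>S. X \<alpha> | X. \<forall>\<alpha>\<in>S. X \<alpha> \<in> root_space m n \<alpha>}"

definition parabolic_set :: "nat \<Rightarrow> nat \<Rightarrow> weight set \<Rightarrow> bool" where
  "parabolic_set m n P \<longleftrightarrow>
     P \<subset> roots m n \<and> roots m n = P \<union> uminus ` P \<and>
     (\<forall>\<alpha>\<in>P. \<forall>\<beta>\<in>P. \<alpha> + \<beta> \<in> roots m n \<longrightarrow> \<alpha> + \<beta> \<in> P)"

definition levi_component :: "weight set \<Rightarrow> weight set" where
  "levi_component P = P \<inter> uminus ` P"

definition nil_component :: "weight set \<Rightarrow> weight set" where
  "nil_component P = P - uminus ` P"

definition nilradical :: "nat \<Rightarrow> nat \<Rightarrow> weight set \<Rightarrow> smat set" where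
  "nilradical m n P = root_space_sum m n (nil_component P)"

definition levi_subalgebra :: "nat \<Rightarrow> nat \<Rightarrow> weight set \<Rightarrow> smat lie_superalgebra" where
  "levi_subalgebra m n P =
     lsa_restrict (sl m n)
       {H + X | H X. H \<in> cartan m n \<and> X \<in> root_space_sum m n (levi_component P)}"

definition nilradical_module :: "nat \<Rightarrow> nat \<Rightarrow> weight set \<Rightarrow> (smat, smat) super_module" where
  "nilradical_module m n P =
     \<lparr>mspace = nilradical m n P, meven = even_part (sl m n), modd = odd_part (sl m n),
      mscale = mat_scale, act = bracket (sl m n)\<rparr>"

definition cominuscule :: "nat \<Rightarrow> nat \<Rightarrow> weight set \<Rightarrow> bool" where
  "cominuscule m n P \<longleftrightarrow>
     (\<forall>X\<in>nilradical m n P. \<forall>Y\<in>nilradical m n P. bracket (sl m n) X Y = 0)"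

definition weyl_group :: "nat \<Rightarrow> nat \<Rightarrow> ((nat \<Rightarrow> nat) \<times> (nat \<Rightarrow> nat)) set" where
  "weyl_group m n = {(\<sigma>, \<tau>). \<sigma> permutes {1..m} \<and> \<tau> permutes {1..n}}"

definition weyl_perm :: "(nat \<Rightarrow> nat) \<times> (nat \<Rightarrow> nat) \<Rightarrow> idx \<Rightarrow> idx" where
  "weyl_perm w = map_sum (fst w) (snd w)"

text \<open>The action on matrices (simultaneous permutation of rows and columns) and, dually, on weights.\<close>

definition weyl_conj :: "(nat \<Rightarrow> nat) \<times> (nat \<Rightarrow> nat) \<Rightarrow> smat \<Rightarrow> smat" where
  "weyl_conj w X = (\<lambda>a b. X (inv (weyl_perm w) a) (inv (weyl_perm w) b))"

definition weyl_act :: "(nat \<Rightarrow> nat) \<times> (nat \<Rightarrow> nat) \<Rightarrow> weight \<Rightarrow> weight" where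
  "weyl_act w \<alpha> = (\<lambda>H. \<alpha> (\<lambda>a b. H (weyl_perm w a) (weyl_perm w b)))"

lemma cartan_permute:
  assumes "w \<in> weyl_group m n" "H \<in> cartan m n"
  shows "(\<lambda>a b. H (weyl_perm w a) (weyl_perm w b)) \<in> cartan m n"
proof -
  obtain \<sigma> \<tau> where w: "w = (\<sigma>, \<tau>)" and p: "\<sigma> permutes {1..m}" "\<tau> permutes {1..n}"
    using assms(1) by (auto simp: weyl_group_def)
  have inj: "weyl_perm w a = weyl_perm w b \<longleftrightarrow> a = b" for a b
    using permutes_inj[OF p(1)] permutes_inj[OF p(2)]
    by (cases a; cases b) (auto simp: w weyl_perm_def inj_eq)
  have mem: "weyl_perm w a \<in> idx_set m n \<longleftrightarrow> a \<in> idx_set m n" for a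
    using permutes_in_image[OF p(1)] permutes_in_image[OF p(2)]
    by (cases a) (auto simp: w weyl_perm_def idx_set_def)
  have "(\<Sum>i=1..m. H (Inl (\<sigma> i)) (Inl (\<sigma> i))) = (\<Sum>i=1..m. H (Inl i) (Inl i))"
    "(\<Sum>k=1..n. H (Inr (\<tau> k)) (Inr (\<tau> k))) = (\<Sum>k=1..n. H (Inr k) (Inr k))"
    using sum.permute[OF p(1), of "\<lambda>i. H (Inl i) (Inl i)"]
      sum.permute[OF p(2), of "\<lambda>k. H (Inr k) (Inr k)"] by (simp_all add: o_def)
  then have "supertrace m n (\<lambda>a b. H (weyl_perm w a) (weyl_perm w b)) = supertrace m n H"
    by (simp add: supertrace_def w weyl_perm_def)
  then show ?thesis
    using assms(2) by (simp add: cartan_def sl_def gl_def lsa_restrict_def inj) (metis mem)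
qed

lemma cartan_permute_iff:
  assumes w: "w \<in> weyl_group m n"
  shows "(\<lambda>a b. H (weyl_perm w a) (weyl_perm w b)) \<in> cartan m n \<longleftrightarrow> H \<in> cartan m n"
proof
  obtain \<sigma> \<tau> where w': "w = (\<sigma>, \<tau>)" and p: "\<sigma> permutes {1..m}" "\<tau> permutes {1..n}"
    using w by (auto simp: weyl_group_def)
  have v: "(inv \<sigma>, inv \<tau>) \<in> weyl_group m n"
    using p by (simp add: weyl_group_def permutes_inv)
  have c: "weyl_perm w (weyl_perm (inv \<sigma>, inv \<tau>) a) = a" for a
    by (cases a) (simp_all add: w' weyl_perm_def permutes_inverses[OF p(1)] permutes_inverses[OF p(2)])
  assume "(\<lambda>a b. H (weyl_perm w a) (weyl_perm w b)) \<in> cartan m n"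
  from cartan_permute[OF v this] show "H \<in> cartan m n" by (simp add: c)
qed (rule cartan_permute[OF w])

lemma weyl_act_eps_del:
  assumes "(\<sigma>, \<tau>) \<in> weyl_group m n"
  shows "weyl_act (\<sigma>, \<tau>) (eps m n i) = eps m n (\<sigma> i)"
    and "weyl_act (\<sigma>, \<tau>) (del m n k) = del m n (\<tau> k)"
  using cartan_permute_iff[OF assms]
  by (auto simp: weyl_act_def eps_def del_def weyl_perm_def)

section \<open>The standard cominuscule parabolic sets\<close>

definition std_levi :: "nat \<Rightarrow> nat \<Rightarrow> nat \<Rightarrow> nat \<Rightarrow> weight set" where
  "std_levi m n m0 n0 =
     {eps m n i - eps m n j | i j. i \<in> {1..m} \<and> j \<in> {1..m} \<and> i \<noteq> j \<and> (i \<le> m0 \<longleftrightarrow> j \<le> m0)} \<union>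
     {del m n k - del m n l | k l. k \<in> {1..n} \<and> l \<in> {1..n} \<and> k \<noteq> l \<and> (k \<le> n0 \<longleftrightarrow> l \<le> n0)} \<union>
     {eps m n i - del m n l | i l. i \<in> {1..m} \<and> l \<in> {1..n} \<and> (i \<le> m0 \<longleftrightarrow> l \<le> n0)} \<union>
     {del m n l - eps m n i | i l. i \<in> {1..m} \<and> l \<in> {1..n} \<and> (i \<le> m0 \<longleftrightarrow> l \<le> n0)}"

definition std_nil :: "nat \<Rightarrow> nat \<Rightarrow> nat \<Rightarrow> nat \<Rightarrow> weight set" where
  "std_nil m n m0 n0 =
     {eps m n i - eps m n j | i j. i \<in> {1..m} \<and> j \<in> {1..m} \<and> i \<le> m0 \<and> m0 < j} \<union>
     {del m n k - del m n l | k l. k \<in> {1..n} \<and> l \<in> {1..n} \<and> k \<le> n0 \<and> n0 < l} \<union>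
     {eps m n i - del m n l | i l. i \<in> {1..m} \<and> l \<in> {1..n} \<and> i \<le> m0 \<and> n0 < l} \<union>
     {del m n k - eps m n j | j k. j \<in> {1..m} \<and> k \<in> {1..n} \<and> k \<le> n0 \<and> m0 < j}"

definition std_parabolic :: "nat \<Rightarrow> nat \<Rightarrow> nat \<Rightarrow> nat \<Rightarrow> weight set" where
  "std_parabolic m n m0 n0 = std_levi m n m0 n0 \<union> std_nil m n m0 n0"

definition admissible :: "nat \<Rightarrow> nat \<Rightarrow> nat \<Rightarrow> nat \<Rightarrow> bool" where
  "admissible m n m0 n0 \<longleftrightarrow>
     m0 \<le> m \<and> n0 \<le> n \<and> (m0, n0) \<noteq> (0, 0) \<and> (m0, n0) \<noteq> (m, n)"

text \<open>
  The diagonal block of format (p|q) whose even indices start after \<open>r\<close> and whose odd indices start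
  after \<open>s\<close>. The blocks at (0|0) and (m0|n0) give the inclusion of the Levi subalgebra of
  \<open>std_parabolic m n m0 n0\<close> into the direct sum of gl(m0|n0) and gl(m - m0|n - n0).
\<close>

definition diag_block :: "nat \<Rightarrow> nat \<Rightarrow> nat \<Rightarrow> nat \<Rightarrow> smat \<Rightarrow> smat" where
  "diag_block r s p q X = (\<lambda>a b.
     if a \<in> idx_set p q \<and> b \<in> idx_set p q
     then X (map_sum ((+) r) ((+) s) a) (map_sum ((+) r) ((+) s) b) else 0)"

text \<open>
  The tensor product of the standard representation of gl(m0|n0) with the dual of that of
  gl(m - m0|n - n0), restricted to the Levi subalgebra of a parabolic set which the Weyl group
  element \<open>w\<close> carries to \<open>std_parabolic m n m0 n0\<close>.
\<close>

definition nil_model ::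
  "nat \<Rightarrow> nat \<Rightarrow> nat \<Rightarrow> nat \<Rightarrow> (nat \<Rightarrow> nat) \<times> (nat \<Rightarrow> nat) \<Rightarrow> (smat, idx \<times> idx \<Rightarrow> complex) super_module"
where
  "nil_model m n m0 n0 w = rep_module
     (rep_pullback (weyl_conj w)
       (rep_tensor
         (rep_pullback (diag_block 0 0 m0 n0) (std_rep m0 n0))
         (rep_dual (rep_pullback (diag_block m0 n0 (m - m0) (n - n0)) (std_rep (m - m0) (n - n0))))))"

end

theory Submission
  imports Defs
begin

text \<open>
  Write \<open>I\<close> for the set of all \<open>m + n\<close> even and odd indices, and write every root as \<open>\<chi>\<^sub>a - \<chi>\<^sub>b\<close> with \<open>a \<noteq> b\<close>
  in \<open>I\<close>, where \<open>\<chi>\<^sub>a\<close> (\<open>coord\<close> below) reads off the diagonal entry \<open>a\<close>. Since \<open>m \<noteq> n\<close>, the identity matrix has nonzero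
  supertrace, so the Cartan subalgebra and the scalars together span all diagonal matrices. Scalars are
  invisible to the differences \<open>\<chi>\<^sub>a - \<chi>\<^sub>b\<close>; hence these are pairwise distinct, and the root space of
  \<open>\<chi>\<^sub>a - \<chi>\<^sub>b\<close> is the line of the matrix unit \<open>E\<^sub>a\<^sub>b\<close> (\<open>inj_on_root\<close>, \<open>root_space_iff\<close>). Everything becomes a
  question about sets of pairs of indices.

  A parabolic set is then a total preorder on \<open>I\<close>, and its nilradical is spanned by the \<open>E\<^sub>a\<^sub>b\<close> with \<open>a\<close>
  strictly above \<open>b\<close>. The nilradical is abelian exactly when there are no three levels, so a cominuscule
  parabolic set is given by a splitting of \<open>I\<close> into an upper class \<open>A\<close> and a lower class \<open>B\<close>, both nonempty
  (\<open>cominuscule_two_classes\<close>). The Weyl group permutes even and odd indices separately, so the orbit of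
  \<open>A\<close> is determined by its numbers \<open>m0\<close> of even and \<open>n0\<close> of odd elements (\<open>unique_standard_conjugate\<close>).

  The Levi subalgebra consists of the block diagonal matrices for \<open>A\<close> and \<open>B\<close> of supertrace zero. Reading
  off the two blocks identifies it with the pairs in \<open>gl(m0|n0) \<oplus> gl(m - m0|n - n0)\<close> with opposite
  supertraces (\<open>blocks_iso\<close>). The pairs with both supertraces zero form an ideal, with a complement spanned
  by a diagonal matrix whose blocks have supertraces \<open>1\<close> and \<open>-1\<close> (\<open>levi_semidirect_sum\<close>). If the
  identity of each block has nonzero supertrace, multiples of it can be split off from both blocks,
  which makes the sum direct (\<open>levi_direct_sum\<close>). Finally, a matrix in the nilradical is a rectangular
  array with rows in \<open>A\<close> and columns in \<open>B\<close>, and the signs in the superbracket are precisely those of the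
  tensor product with a dual (\<open>sbracket_nil\<close>).
\<close>

section \<open>Roots as pairs of indices\<close>

lemma finite_idx_set [simp]: "finite (idx_set m n)"
  by (simp add: idx_set_def)

lemma idx_set_simps [simp]:
  "Inl i \<in> idx_set m n \<longleftrightarrow> 1 \<le> i \<and> i \<le> m"
  "Inr k \<in> idx_set m n \<longleftrightarrow> 1 \<le> k \<and> k \<le> n"
  by (auto simp: idx_set_def)

lemma par_simps [simp]: "par (Inl i) = 0" "par (Inr k) = 1"
  by (simp_all add: par_def)

lemma sum_idx_set:
  "(\<Sum>a\<in>idx_set m n. h a) = (\<Sum>i=1..m. h (Inl i)) + (\<Sum>k=1..n. h (Inr k))"
  unfolding idx_set_def by (simp add: sum.Plus)

lemma supertrace_idx: "supertrace m n A = (\<Sum>a\<in>idx_set m n. (-1) ^ par a * A a a)"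
  by (simp add: supertrace_def sum_idx_set sum_negf)

lemma sum_fun_eval: "(\<Sum>x\<in>S. F x) a = (\<Sum>x\<in>S. F x a)"
  by (induction S rule: infinite_finite_induct) simp_all

lemma gl_space: "A \<in> lspace (gl m n) \<longleftrightarrow> (\<forall>a b. A a b \<noteq> 0 \<longrightarrow> a \<in> idx_set m n \<and> b \<in> idx_set m n)"
  by (simp add: gl_def)

lemma sl_space: "A \<in> lspace (sl m n) \<longleftrightarrow> A \<in> lspace (gl m n) \<and> supertrace m n A = 0"
  by (simp add: sl_def lsa_restrict_def)

lemma sl_simps [simp]:
  "even_part (sl m n) = {A. homogeneous_mat 0 A}" "odd_part (sl m n) = {A. homogeneous_mat 1 A}"
  "lscale (sl m n) = mat_scale" "bracket (sl m n) = sbracket m n"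
  by (simp_all add: sl_def gl_def lsa_restrict_def)

lemma gl_simps [simp]:
  "even_part (gl m n) = {A. homogeneous_mat 0 A}" "odd_part (gl m n) = {A. homogeneous_mat 1 A}"
  "lscale (gl m n) = mat_scale" "bracket (gl m n) = sbracket m n"
  by (simp_all add: gl_def)

lemma cartan_iff:
  "H \<in> cartan m n \<longleftrightarrow> (\<forall>a b. H a b \<noteq> 0 \<longrightarrow> a = b \<and> a \<in> idx_set m n) \<and> supertrace m n H = 0"
  unfolding cartan_def by (auto simp: sl_space gl_space)

definition coord :: "nat \<Rightarrow> nat \<Rightarrow> idx \<Rightarrow> weight" where
  "coord m n a = (\<lambda>H. if H \<in> cartan m n then H a a else 0)"

definition pair_root :: "nat \<Rightarrow> nat \<Rightarrow> idx \<times> idx \<Rightarrow> weight" where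
  "pair_root m n = (\<lambda>(a, b). coord m n a - coord m n b)"

definition offdiag :: "nat \<Rightarrow> nat \<Rightarrow> (idx \<times> idx) set" where
  "offdiag m n = {(a, b). a \<in> idx_set m n \<and> b \<in> idx_set m n \<and> a \<noteq> b}"

lemma finite_offdiag [simp]: "finite (offdiag m n)"
  by (rule finite_subset[of _ "idx_set m n \<times> idx_set m n"]) (auto simp: offdiag_def)

lemma coord_simps: "coord m n (Inl i) = eps m n i" "coord m n (Inr k) = del m n k"
  by (simp_all add: coord_def eps_def del_def)

lemma root_uminus: "- pair_root m n (a, b) = pair_root m n (b, a)"
  by (simp add: pair_root_def)

lemma root_add: "pair_root m n (a, b) + pair_root m n (b, c) = pair_root m n (a, c)"
  by (simp add: pair_root_def)

lemma uminus_root_image: "uminus ` pair_root m n ` K = pair_root m n ` (K\<inverse>)"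
proof -
  have "uminus (pair_root m n p) = pair_root m n (prod.swap p)" for p
    by (cases p) (simp add: root_uminus)
  then show ?thesis by (force simp: image_iff)
qed

text \<open>Translates between sets of index pairs and the lists of roots in terms of \<open>eps\<close> and \<open>del\<close>.\<close>

lemma root_image_split:
  assumes "K \<subseteq> offdiag m n"
  shows "pair_root m n ` K =
     {eps m n i - eps m n j | i j. (Inl i, Inl j) \<in> K} \<union>
     {del m n k - del m n l | k l. (Inr k, Inr l) \<in> K} \<union>
     {eps m n i - del m n l | i l. (Inl i, Inr l) \<in> K} \<union>
     {del m n l - eps m n i | i l. (Inr l, Inl i) \<in> K}" (is "_ = ?R")
proof
  show "?R \<subseteq> pair_root m n ` K"
    by (force simp: pair_root_def coord_simps image_iff)
  show "pair_root m n ` K \<subseteq> ?R"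
  proof
    fix \<alpha> assume "\<alpha> \<in> pair_root m n ` K"
    then obtain a b where "(a, b) \<in> K" "\<alpha> = coord m n a - coord m n b"
      by (auto simp: pair_root_def)
    then show "\<alpha> \<in> ?R" by (cases a; cases b) (auto simp: coord_simps)
  qed
qed

lemma roots_eq: "roots m n = pair_root m n ` offdiag m n"
  unfolding root_image_split[OF subset_refl] by (auto simp: roots_def offdiag_def)

text \<open>
  Subtracting a multiple of the identity moves every diagonal matrix into the Cartan subalgebra,
  because the supertrace \<open>m - n\<close> of the identity is nonzero; differences of diagonal entries are not
  affected. Hence the functionals \<open>coord a - coord b\<close> are as independent on the Cartan subalgebra as on
  all diagonal matrices.
\<close>

definition cartan_probe :: "nat \<Rightarrow> nat \<Rightarrow> (idx \<Rightarrow> complex) \<Rightarrow> smat" where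
  "cartan_probe m n d = (\<lambda>a b. if a = b \<and> a \<in> idx_set m n
     then d a - (\<Sum>c\<in>idx_set m n. (-1) ^ par c * d c) / (of_nat m - of_nat n) else 0)"

lemma cartan_probe_in_cartan:
  assumes "m \<noteq> n"
  shows "cartan_probe m n d \<in> cartan m n"
proof -
  have 1: "(\<Sum>c\<in>idx_set m n. (-1) ^ par c) = (of_nat m - of_nat n :: complex)"
    by (simp add: sum_idx_set)
  have "of_nat m - of_nat n \<noteq> (0::complex)" using assms by simp
  moreover have "supertrace m n (cartan_probe m n d) = (\<Sum>c\<in>idx_set m n. (-1) ^ par c * d c)
      - (\<Sum>c\<in>idx_set m n. (-1) ^ par c) * ((\<Sum>c\<in>idx_set m n. (-1) ^ par c * d c) / (of_nat m - of_nat n))"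
    unfolding supertrace_idx sum_distrib_right sum_subtractf[symmetric]
    by (intro sum.cong) (simp_all add: cartan_probe_def right_diff_distrib)
  ultimately have "supertrace m n (cartan_probe m n d) = 0"
    by (simp add: 1)
  then show ?thesis by (auto simp: cartan_iff cartan_probe_def split: if_splits)
qed

lemma root_cartan:
  "H \<in> cartan m n \<Longrightarrow> pair_root m n (a, b) H = H a a - H b b"
  by (simp add: pair_root_def coord_def)

lemma root_probe:
  assumes "m \<noteq> n" "a \<in> idx_set m n" "b \<in> idx_set m n"
  shows "pair_root m n (a, b) (cartan_probe m n d) = d a - d b"
  using assms by (simp add: root_cartan cartan_probe_in_cartan) (simp add: cartan_probe_def)

lemma inj_on_root:
  assumes "m \<noteq> n"
  shows "inj_on (pair_root m n) (offdiag m n)"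
proof (rule inj_onI, clarsimp simp: offdiag_def)
  fix a b c d
  assume *: "a \<in> idx_set m n" "b \<in> idx_set m n" "c \<in> idx_set m n" "d \<in> idx_set m n"
    "a \<noteq> b" "c \<noteq> d" "pair_root m n (a, b) = pair_root m n (c, d)"
  have "h a - h b = h c - h d" for h :: "idx \<Rightarrow> complex"
    using root_probe[OF assms *(1,2), of h] root_probe[OF assms *(3,4), of h] *(7) by simp
  from this[of "\<lambda>x. if x = a then 1 else 0"] this[of "\<lambda>x. if x = b then 1 else 0"] *
  show "a = c \<and> b = d" by (auto split: if_splits)
qed

section \<open>Root spaces, and cominuscule parabolic sets as two-class preorders\<close>

lemma sbracket_diagonal:
  assumes H: "\<forall>a b. H a b \<noteq> 0 \<longrightarrow> a = b" and X: "X \<in> lspace (gl m n)"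
  shows "sbracket m n H X a b = (H a a - H b b) * X a b"
    and "sbracket m n X H a b = (H b b - H a a) * X a b"
proof -
  let ?I = "idx_set m n"
  have supp: "X a b \<noteq> 0 \<Longrightarrow> a \<in> ?I \<and> b \<in> ?I" using X by (simp add: gl_space)
  have H0: "c \<noteq> d \<Longrightarrow> H c d = 0" for c d using H by blast
  have l: "(\<Sum>c\<in>?I. s c * (H a c * X c b)) = s a * (H a a * X a b)" for s
  proof -
    have "(\<Sum>c\<in>?I. s c * (H a c * X c b)) = (\<Sum>c\<in>?I. if c = a then s a * (H a a * X a b) else 0)"
      by (intro sum.cong) (auto simp: H0)
    then show ?thesis using supp by auto
  qed
  have r: "(\<Sum>c\<in>?I. s c * (X a c * H c b)) = s b * (X a b * H b b)" for s
  proof -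
    have "(\<Sum>c\<in>?I. s c * (X a c * H c b)) = (\<Sum>c\<in>?I. if c = b then s b * (X a b * H b b) else 0)"
      by (intro sum.cong) (auto simp: H0)
    then show ?thesis using supp by auto
  qed
  define sg :: "idx \<Rightarrow> complex" where "sg c = (-1) ^ ((par a + par c) * (par c + par b))" for c
  have sg: "sg a = 1" "sg b = 1" by (simp_all add: sg_def minus_one_power_iff)
  show "sbracket m n H X a b = (H a a - H b b) * X a b"
    using l[of "\<lambda>_. 1"] unfolding sbracket_def sum_subtractf sg_def[symmetric] r sg
    by (simp add: algebra_simps)
  show "sbracket m n X H a b = (H b b - H a a) * X a b"
    using r[of "\<lambda>_. 1"] unfolding sbracket_def sum_subtractf sg_def[symmetric] l sg
    by (simp add: algebra_simps)
qed

lemma sbracket_cartan_left: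
  assumes "H \<in> cartan m n" "X \<in> lspace (gl m n)"
  shows "sbracket m n H X a b = (H a a - H b b) * X a b"
  using assms by (intro sbracket_diagonal) (auto simp: cartan_iff)

lemma root_space_iff:
  assumes mn: "m \<noteq> n" and ab: "(a, b) \<in> offdiag m n"
  shows "X \<in> root_space m n (pair_root m n (a, b)) \<longleftrightarrow> (\<forall>c d. X c d \<noteq> 0 \<longrightarrow> (c, d) = (a, b))"
proof
  assume X: "X \<in> root_space m n (pair_root m n (a, b))"
  show "\<forall>c d. X c d \<noteq> 0 \<longrightarrow> (c, d) = (a, b)"
  proof (intro allI impI)
    fix c d assume cd: "X c d \<noteq> 0"
    have gl: "X \<in> lspace (gl m n)" using X by (simp add: root_space_def sl_space)
    have I: "c \<in> idx_set m n" "d \<in> idx_set m n" using gl cd by (auto simp: gl_space)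
    have eq: "h c - h d = h a - h b" for h :: "idx \<Rightarrow> complex"
    proof -
      let ?H = "cartan_probe m n h"
      have H: "?H \<in> cartan m n" by (rule cartan_probe_in_cartan[OF mn])
      have "sbracket m n ?H X = mat_scale (pair_root m n (a, b) ?H) X"
        using X H by (simp add: root_space_def)
      then have "(?H c c - ?H d d) * X c d = pair_root m n (a, b) ?H * X c d"
        unfolding sbracket_cartan_left[OF H gl, symmetric] by (simp only: mat_scale_def)
      then have "?H c c - ?H d d = pair_root m n (a, b) ?H"
        using cd mult_right_cancel by blast
      then have "pair_root m n (c, d) ?H = pair_root m n (a, b) ?H"
        using root_cartan[OF H, of c d] by simp
      then show ?thesis
        using root_probe[OF mn] I ab by (simp add: offdiag_def)
    qed
    from eq[of "\<lambda>x. if x = a then 1 else 0"] eq[of "\<lambda>x. if x = b then 1 else 0"] ab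
    show "(c, d) = (a, b)" by (auto simp: offdiag_def split: if_splits)
  qed
next
  assume *: "\<forall>c d. X c d \<noteq> 0 \<longrightarrow> (c, d) = (a, b)"
  then have gl: "X \<in> lspace (gl m n)" using ab by (auto simp: gl_space offdiag_def)
  have "X c c = 0" for c using * ab by (auto simp: offdiag_def)
  then have "X \<in> lspace (sl m n)" using gl by (simp add: sl_space supertrace_idx)
  moreover have "sbracket m n H X = mat_scale (pair_root m n (a, b) H) X" if H: "H \<in> cartan m n" for H
  proof (intro ext)
    fix c d
    show "sbracket m n H X c d = mat_scale (pair_root m n (a, b) H) X c d"
      using * by (cases "X c d = 0") (auto simp: sbracket_cartan_left[OF H gl] mat_scale_def root_cartan[OF H])
  qed
  ultimately show "X \<in> root_space m n (pair_root m n (a, b))" by (simp add: root_space_def)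
qed

lemma root_space_sum_iff:
  assumes mn: "m \<noteq> n" and K: "K \<subseteq> offdiag m n"
  shows "X \<in> root_space_sum m n (pair_root m n ` K) \<longleftrightarrow> (\<forall>a b. X a b \<noteq> 0 \<longrightarrow> (a, b) \<in> K)"
proof
  assume "X \<in> root_space_sum m n (pair_root m n ` K)"
  then obtain Y where X: "X = (\<Sum>\<alpha>\<in>pair_root m n ` K. Y \<alpha>)"
    and Y: "\<forall>\<alpha>\<in>pair_root m n ` K. Y \<alpha> \<in> root_space m n \<alpha>"
    by (auto simp: root_space_sum_def)
  show "\<forall>a b. X a b \<noteq> 0 \<longrightarrow> (a, b) \<in> K"
  proof (intro allI impI)
    fix a b assume "X a b \<noteq> 0"
    then have "(\<Sum>\<alpha>\<in>pair_root m n ` K. Y \<alpha> a b) \<noteq> 0" by (simp add: X sum_fun_eval)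
    then obtain p where p: "p \<in> K" "Y (pair_root m n p) a b \<noteq> 0"
      by (metis (no_types, lifting) image_iff sum.neutral)
    then show "(a, b) \<in> K"
      using Y K root_space_iff[OF mn, of "fst p" "snd p" "Y (pair_root m n p)"] by auto
  qed
next
  assume *: "\<forall>a b. X a b \<noteq> 0 \<longrightarrow> (a, b) \<in> K"
  define E where "E p = (\<lambda>a b. if (a, b) = p then X a b else 0)" for p
  have inj: "inj_on (pair_root m n) K" using inj_on_root[OF mn] K by (rule inj_on_subset)
  have fin: "finite K" using K finite_offdiag by (rule finite_subset)
  define Y where "Y \<alpha> = E (the_inv_into K (pair_root m n) \<alpha>)" for \<alpha>
  have Y: "Y (pair_root m n p) = E p" if "p \<in> K" for p
    using that inj by (simp add: Y_def the_inv_into_f_f)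
  have "(\<Sum>\<alpha>\<in>pair_root m n ` K. Y \<alpha>) = X"
  proof (intro ext)
    fix a b
    have "(\<Sum>\<alpha>\<in>pair_root m n ` K. Y \<alpha>) a b = (\<Sum>p\<in>K. E p a b)"
      using Y by (simp add: sum_fun_eval sum.reindex[OF inj])
    also have "\<dots> = (\<Sum>p\<in>K. if p = (a, b) then X a b else 0)"
      by (intro sum.cong) (auto simp: E_def)
    also have "\<dots> = X a b" using * fin by auto
    finally show "(\<Sum>\<alpha>\<in>pair_root m n ` K. Y \<alpha>) a b = X a b" .
  qed
  moreover have "Y (pair_root m n p) \<in> root_space m n (pair_root m n p)" if "p \<in> K" for p
    using that K root_space_iff[OF mn, of "fst p" "snd p" "E p"] by (auto simp: Y E_def)
  ultimately show "X \<in> root_space_sum m n (pair_root m n ` K)"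
    unfolding root_space_sum_def by blast
qed

text \<open>
  The pairs \<open>a \<ge> b\<close> of the preorder in which \<open>A\<close> and its complement are the classes and \<open>A\<close> is on top.
\<close>

definition block_parabolic :: "nat \<Rightarrow> nat \<Rightarrow> idx set \<Rightarrow> weight set" where
  "block_parabolic m n A = pair_root m n ` {(a, b) \<in> offdiag m n. b \<in> A \<longrightarrow> a \<in> A}"

lemma levi_component_block:
  assumes "m \<noteq> n"
  shows "levi_component (block_parabolic m n A) = pair_root m n ` {(a, b) \<in> offdiag m n. a \<in> A \<longleftrightarrow> b \<in> A}"
  unfolding levi_component_def block_parabolic_def uminus_root_image
  by (subst inj_on_image_Int[OF inj_on_root[OF assms], symmetric])
    (auto simp: offdiag_def intro!: arg_cong[where f = "image _"])

lemma nil_component_block: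
  assumes "m \<noteq> n" "A \<subseteq> idx_set m n"
  shows "nil_component (block_parabolic m n A) = pair_root m n ` (A \<times> (idx_set m n - A))"
  unfolding nil_component_def block_parabolic_def uminus_root_image
  using assms(2)
  by (subst inj_on_image_set_diff[OF inj_on_root[OF assms(1)], symmetric])
    (auto simp: offdiag_def intro!: arg_cong[where f = "image _"])

definition mat_unit :: "idx \<Rightarrow> idx \<Rightarrow> smat" where
  "mat_unit a b = (\<lambda>c d. if c = a \<and> d = b then 1 else 0)"

text \<open>
  A parabolic set is a total preorder on the indices, with the diagonal removed: transitivity is
  closedness, as \<open>(\<chi>\<^sub>a - \<chi>\<^sub>b) + (\<chi>\<^sub>b - \<chi>\<^sub>c) = \<chi>\<^sub>a - \<chi>\<^sub>c\<close>. The nilradical is spanned by the matrix units of the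
  strictly comparable pairs. A strict chain \<open>a > b > c\<close> would give \<open>[E\<^sub>a\<^sub>b, E\<^sub>b\<^sub>c] = E\<^sub>a\<^sub>c \<noteq> 0\<close>, so there are at
  most two classes; there are two because the parabolic set is proper.
\<close>

lemma cominuscule_two_classes:
  assumes mn: "m \<noteq> n" and P: "parabolic_set m n P" and com: "cominuscule m n P"
  obtains A where "A \<subseteq> idx_set m n" "A \<noteq> {}" "A \<noteq> idx_set m n" "P = block_parabolic m n A"
proof -
  let ?I = "idx_set m n"
  define K where "K = {p \<in> offdiag m n. pair_root m n p \<in> P}"
  have PK: "P = pair_root m n ` K"
    using P by (auto simp: parabolic_set_def roots_eq K_def)
  have K: "K \<subseteq> offdiag m n" by (auto simp: K_def)
  have inj: "inj_on (pair_root m n) (offdiag m n)" by (rule inj_on_root[OF mn])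
  have cv: "K\<inverse> \<subseteq> offdiag m n" using K by (auto simp: offdiag_def)
  have "pair_root m n ` offdiag m n = pair_root m n ` (K \<union> K\<inverse>)"
    using P by (simp add: parabolic_set_def roots_eq PK uminus_root_image image_Un)
  then have total: "offdiag m n = K \<union> K\<inverse>"
    using inj_on_image_eq_iff[OF inj, of "offdiag m n" "K \<union> K\<inverse>"] K cv by auto
  have trans: "(a, c) \<in> K" if "(a, b) \<in> K" "(b, c) \<in> K" "a \<noteq> c" for a b c
  proof -
    have off: "(a, c) \<in> offdiag m n" using that K by (auto simp: offdiag_def)
    have "pair_root m n (a, b) + pair_root m n (b, c) \<in> roots m n"
      using off by (simp add: root_add roots_eq)
    then have "pair_root m n (a, c) \<in> P"
      using P that unfolding parabolic_set_def by (metis (no_types, lifting) PK image_eqI root_add)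
    then show ?thesis using off by (simp add: K_def)
  qed
  define N where "N = K - K\<inverse>"
  have N: "N \<subseteq> offdiag m n" using K by (auto simp: N_def)
  have nil: "nil_component P = pair_root m n ` N"
    unfolding nil_component_def PK uminus_root_image N_def
    by (rule inj_on_image_set_diff[OF inj, symmetric]) (use K cv in auto)
  have no_chain: False if ab: "(a, b) \<in> N" and bc: "(b, c) \<in> N" for a b c
  proof -
    have ac: "a \<noteq> c" using ab bc by (auto simp: N_def)
    have b: "b \<in> ?I" using ab N by (auto simp: offdiag_def)
    have "mat_unit a b \<in> nilradical m n P" "mat_unit b c \<in> nilradical m n P"
      using ab bc by (auto simp: nilradical_def nil root_space_sum_iff[OF mn N] mat_unit_def split: if_splits)
    then have "sbracket m n (mat_unit a b) (mat_unit b c) = 0"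
      using com by (simp add: cominuscule_def)
    then have "sbracket m n (mat_unit a b) (mat_unit b c) a c = 0" by simp
    moreover have "sbracket m n (mat_unit a b) (mat_unit b c) a c = (\<Sum>d\<in>?I. if d = b then 1 else 0)"
      unfolding sbracket_def using ac by (intro sum.cong) (auto simp: mat_unit_def)
    ultimately show False using b by simp
  qed
  have "K \<noteq> offdiag m n" using P by (auto simp: parabolic_set_def roots_eq PK)
  then obtain u v where uv: "(u, v) \<in> N"
    using K total by (auto simp: N_def)
  \<comment> \<open>The upper class: the indices that have something strictly below them.\<close>
  define A where "A = fst ` N"
  have A: "A \<subseteq> ?I" using N by (auto simp: A_def offdiag_def)
  have "u \<in> A" using uv by (force simp: A_def)
  have "v \<notin> A" using uv no_chain by (force simp: A_def)
  moreover have "v \<in> ?I" using uv N by (auto simp: offdiag_def)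
  ultimately have "A \<noteq> ?I" by blast
  have "K = {(a, b) \<in> offdiag m n. b \<in> A \<longrightarrow> a \<in> A}"
  proof (intro equalityI subsetI; clarify)
    fix a b assume ab: "(a, b) \<in> K"
    have "a \<in> A" if "b \<in> A"
    proof -
      obtain c where bc: "(b, c) \<in> N" using \<open>b \<in> A\<close> by (auto simp: A_def)
      have "c \<noteq> a" using ab bc by (auto simp: N_def)
      moreover have "(c, a) \<notin> K"
      proof
        assume "(c, a) \<in> K"
        then have "(c, b) \<in> K" using ab bc trans[of c a b] by (auto simp: N_def K_def offdiag_def)
        then show False using bc by (simp add: N_def)
      qed
      ultimately have "(a, c) \<in> N" using trans[OF ab, of c] bc by (auto simp: N_def)
      then show "a \<in> A" by (force simp: A_def)
    qed
    then show "(a, b) \<in> offdiag m n \<and> (b \<in> A \<longrightarrow> a \<in> A)" using ab K by auto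
  next
    fix a b assume ab: "(a, b) \<in> offdiag m n" "b \<in> A \<longrightarrow> a \<in> A"
    show "(a, b) \<in> K"
    proof (rule ccontr)
      assume n: "(a, b) \<notin> K"
      then have ba: "(b, a) \<in> N" using ab total by (auto simp: N_def)
      then have "b \<in> A" by (force simp: A_def)
      then obtain c where "(a, c) \<in> N" using ab by (auto simp: A_def)
      with ba show False using no_chain by blast
    qed
  qed
  then have "P = block_parabolic m n A" by (simp add: PK block_parabolic_def)
  with A \<open>u \<in> A\<close> \<open>A \<noteq> ?I\<close> show ?thesis using that by blast
qed

section \<open>Conjugacy under the Weyl group\<close>

lemma std_parabolic_block:
  "std_parabolic m n m0 n0 = block_parabolic m n (idx_set m0 n0)"
proof -
  let ?K = "{(a, b) \<in> offdiag m n. b \<in> idx_set m0 n0 \<longrightarrow> a \<in> idx_set m0 n0}"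
  have Un: "{f i j | i j. Q i j} = {f i j | i j. P i j} \<union> {f i j | i j. R i j}"
    if "\<And>i j. Q i j \<longleftrightarrow> P i j \<or> R i j" for f :: "nat \<Rightarrow> nat \<Rightarrow> weight" and P Q R
    using that by blast
  have "?K \<subseteq> offdiag m n" by auto
  note split = root_image_split[OF this]
  have 1: "{eps m n i - eps m n j | i j. (Inl i, Inl j) \<in> ?K} =
      {eps m n i - eps m n j | i j. i \<in> {1..m} \<and> j \<in> {1..m} \<and> i \<noteq> j \<and> (i \<le> m0 \<longleftrightarrow> j \<le> m0)} \<union>
      {eps m n i - eps m n j | i j. i \<in> {1..m} \<and> j \<in> {1..m} \<and> i \<le> m0 \<and> m0 < j}"
    by (rule Un) (auto simp: offdiag_def)
  have 2: "{del m n k - del m n l | k l. (Inr k, Inr l) \<in> ?K} =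
      {del m n k - del m n l | k l. k \<in> {1..n} \<and> l \<in> {1..n} \<and> k \<noteq> l \<and> (k \<le> n0 \<longleftrightarrow> l \<le> n0)} \<union>
      {del m n k - del m n l | k l. k \<in> {1..n} \<and> l \<in> {1..n} \<and> k \<le> n0 \<and> n0 < l}"
    by (rule Un) (auto simp: offdiag_def)
  have 3: "{eps m n i - del m n l | i l. (Inl i, Inr l) \<in> ?K} =
      {eps m n i - del m n l | i l. i \<in> {1..m} \<and> l \<in> {1..n} \<and> (i \<le> m0 \<longleftrightarrow> l \<le> n0)} \<union>
      {eps m n i - del m n l | i l. i \<in> {1..m} \<and> l \<in> {1..n} \<and> i \<le> m0 \<and> n0 < l}"
    by (rule Un) (auto simp: offdiag_def)
  have 4: "{del m n l - eps m n i | i l. (Inr l, Inl i) \<in> ?K} =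
      {del m n l - eps m n i | i l. i \<in> {1..m} \<and> l \<in> {1..n} \<and> (i \<le> m0 \<longleftrightarrow> l \<le> n0)} \<union>
      {del m n l - eps m n i | i l. i \<in> {1..m} \<and> l \<in> {1..n} \<and> l \<le> n0 \<and> m0 < i}"
    by (rule Un) (auto simp: offdiag_def)
  show ?thesis
    unfolding block_parabolic_def split 1 2 3 4 std_parabolic_def std_levi_def std_nil_def
    by (simp only: Un_ac)
qed

lemma weyl_perm_simps [simp]:
  "weyl_perm w (Inl i) = Inl (fst w i)" "weyl_perm w (Inr k) = Inr (snd w k)"
  by (simp_all add: weyl_perm_def)

lemma par_weyl_perm [simp]: "par (weyl_perm w a) = par a"
  by (cases a) simp_all

lemma weyl_perm_permutes:
  assumes "w \<in> weyl_group m n"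
  shows "weyl_perm w permutes idx_set m n"
proof -
  have p: "fst w permutes {1..m}" "snd w permutes {1..n}"
    using assms by (auto simp: weyl_group_def)
  have "inj (weyl_perm w)"
    using permutes_inj[OF p(1)] permutes_inj[OF p(2)]
    by (simp add: weyl_perm_def sum.inj_map)
  moreover have "weyl_perm w ` idx_set m n = idx_set m n"
  proof (rule endo_inj_surj)
    have "weyl_perm w a \<in> idx_set m n" if "a \<in> idx_set m n" for a
      using that permutes_in_image[OF p(1)] permutes_in_image[OF p(2)] by (cases a) auto
    then show "weyl_perm w ` idx_set m n \<subseteq> idx_set m n" by blast
  qed (use \<open>inj (weyl_perm w)\<close> inj_on_subset in auto)
  moreover have "weyl_perm w a = a" if "a \<notin> idx_set m n" for a
    using that permutes_not_in[OF p(1)] permutes_not_in[OF p(2)] by (cases a) auto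
  ultimately show ?thesis
    by (intro bij_imp_permutes) (auto simp: bij_betw_def intro: inj_on_subset)
qed

lemma weyl_act_root:
  assumes "w \<in> weyl_group m n"
  shows "weyl_act w (pair_root m n (a, b)) = pair_root m n (weyl_perm w a, weyl_perm w b)"
proof -
  have "weyl_act w (coord m n c) = coord m n (weyl_perm w c)" for c
    using assms by (cases w; cases c) (simp_all add: coord_simps weyl_act_eps_del)
  then show ?thesis
    by (simp add: pair_root_def weyl_act_def fun_eq_iff)
qed

lemma weyl_act_block:
  assumes w: "w \<in> weyl_group m n"
  shows "weyl_act w ` block_parabolic m n A = block_parabolic m n (weyl_perm w ` A)"
proof -
  let ?\<pi> = "weyl_perm w"
  note perm = weyl_perm_permutes[OF w]
  have "map_prod ?\<pi> ?\<pi> ` {(a, b) \<in> offdiag m n. b \<in> A \<longrightarrow> a \<in> A}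
      = {(a, b) \<in> offdiag m n. b \<in> ?\<pi> ` A \<longrightarrow> a \<in> ?\<pi> ` A}" (is "_ ` ?K = ?L")
  proof (intro equalityI subsetI)
    fix p assume "p \<in> map_prod ?\<pi> ?\<pi> ` ?K"
    then show "p \<in> ?L"
      using permutes_inj[OF perm] permutes_in_image[OF perm]
      by (auto simp: offdiag_def inj_image_mem_iff inj_eq)
  next
    fix p assume p: "p \<in> ?L"
    obtain a b where ab: "p = (?\<pi> a, ?\<pi> b)"
      using permutes_surj[OF perm] by (metis surjD surj_pair)
    with p have "(a, b) \<in> ?K"
      using permutes_inj[OF perm] permutes_in_image[OF perm]
      by (auto simp: offdiag_def inj_image_mem_iff inj_eq)
    then show "p \<in> map_prod ?\<pi> ?\<pi> ` ?K" using ab by force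
  qed
  moreover have "weyl_act w (pair_root m n p) = pair_root m n (map_prod ?\<pi> ?\<pi> p)" for p
    by (cases p) (simp add: weyl_act_root[OF w])
  ultimately show ?thesis
    unfolding block_parabolic_def by (metis (no_types, lifting) image_cong image_image)
qed

text \<open>
  The empty set and the set of all indices both give all roots; among the proper subsets, \<open>A\<close> is
  recovered as the set of indices that lie above some other index without lying below it.
\<close>

lemma block_parabolic_inj:
  assumes mn: "m \<noteq> n" and A: "A \<subset> idx_set m n" "B \<subset> idx_set m n"
    and eq: "block_parabolic m n A = block_parabolic m n B"
  shows "A = B"
proof -
  have "{(a, b) \<in> offdiag m n. b \<in> A \<longrightarrow> a \<in> A} = {(a, b) \<in> offdiag m n. b \<in> B \<longrightarrow> a \<in> B}"
    using eq unfolding block_parabolic_def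
    by (subst (asm) inj_on_image_eq_iff[OF inj_on_root[OF mn]]) auto
  then have *: "(b \<in> A \<longrightarrow> a \<in> A) \<longleftrightarrow> (b \<in> B \<longrightarrow> a \<in> B)"
    if "a \<in> idx_set m n" "b \<in> idx_set m n" "a \<noteq> b" for a b
    using that by (auto simp: offdiag_def set_eq_iff)
  obtain u v where "u \<in> idx_set m n" "u \<notin> A" "v \<in> idx_set m n" "v \<notin> B" using A by blast
  then show ?thesis using * A by blast
qed

lemma permutation_to_initial_segment:
  assumes S: "S \<subseteq> {1..N::nat}"
  shows "\<exists>\<sigma>. \<sigma> permutes {1..N} \<and> \<sigma> ` S = {1..card S}"
proof -
  have fin: "finite S" using S finite_subset by blast
  have le: "card S \<le> N" using card_mono[OF _ S] by simp
  obtain f where f: "bij_betw f S {1..card S}"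
    using finite_same_card_bij[OF fin, of "{1..card S}"] by auto
  have "card ({1..N} - S) = card {card S + 1..N}" using S fin by (simp add: card_Diff_subset)
  then obtain g where g: "bij_betw g ({1..N} - S) {card S + 1..N}"
    using finite_same_card_bij by blast
  define \<sigma> where "\<sigma> x = (if x \<in> S then f x else if x \<in> {1..N} then g x else x)" for x
  have fS: "bij_betw \<sigma> S {1..card S}"
    using f by (subst bij_betw_cong[of S \<sigma> f]) (auto simp: \<sigma>_def)
  have "bij_betw \<sigma> ({1..N} - S) {card S + 1..N}"
    using g by (subst bij_betw_cong[of _ \<sigma> g]) (auto simp: \<sigma>_def)
  then have "bij_betw \<sigma> (S \<union> ({1..N} - S)) ({1..card S} \<union> {card S + 1..N})"
    by (intro bij_betw_combine[OF fS]) auto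
  moreover have "S \<union> ({1..N} - S) = {1..N}" "{1..card S} \<union> {card S + 1..N} = {1..N}"
    using S le by auto
  ultimately have "\<sigma> permutes {1..N}"
    using S by (intro bij_imp_permutes) (auto simp: \<sigma>_def)
  with fS show ?thesis by (auto simp: bij_betw_def)
qed

lemma weyl_orbit_representative:
  assumes "A \<subseteq> idx_set m n"
  shows "\<exists>w\<in>weyl_group m n. weyl_perm w ` A = idx_set (card (Inl -` A)) (card (Inr -` A))"
proof -
  have "Inl -` A \<subseteq> {1..m}" "Inr -` A \<subseteq> {1..n}" using assms by auto
  then obtain \<sigma> \<tau> where st: "\<sigma> permutes {1..m}" "\<tau> permutes {1..n}"
    "\<sigma> ` (Inl -` A) = {1..card (Inl -` A)}" "\<tau> ` (Inr -` A) = {1..card (Inr -` A)}"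
    by (meson permutation_to_initial_segment)
  have "a \<in> A \<longleftrightarrow> a \<in> Inl ` (Inl -` A) \<union> Inr ` (Inr -` A)" for a
    by (cases a) auto
  then have A: "A = Inl ` (Inl -` A) \<union> Inr ` (Inr -` A)" by blast
  have "weyl_perm (\<sigma>, \<tau>) ` (Inl ` S \<union> Inr ` T) = Inl ` \<sigma> ` S \<union> Inr ` \<tau> ` T" for S T
    by (simp add: image_Un image_image)
  from this[of "Inl -` A" "Inr -` A"] have "weyl_perm (\<sigma>, \<tau>) ` A = Inl ` \<sigma> ` (Inl -` A) \<union> Inr ` \<tau> ` (Inr -` A)"
    unfolding A[symmetric] .
  then show ?thesis
    using st by (auto simp: idx_set_def Plus_def weyl_group_def intro!: bexI[of _ "(\<sigma>, \<tau>)"])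
qed

lemma weyl_orbit_invariant:
  assumes w: "w \<in> weyl_group m n" and A: "weyl_perm w ` A = idx_set p q"
  shows "p = card (Inl -` A)" "q = card (Inr -` A)"
proof -
  have perm: "fst w permutes {1..m}" "snd w permutes {1..n}"
    using w by (auto simp: weyl_group_def)
  have mem: "a \<in> A \<longleftrightarrow> weyl_perm w a \<in> idx_set p q" for a
    using A inj_image_mem_iff[OF permutes_inj[OF weyl_perm_permutes[OF w]]] by blast
  have "Inl -` A = fst w -` {1..p}" "Inr -` A = snd w -` {1..q}"
    by (auto simp: mem)
  then show "p = card (Inl -` A)" "q = card (Inr -` A)"
    using permutes_bij[OF perm(1)] permutes_bij[OF perm(2)] card_vimage_inj
    by (auto simp: bij_def card_vimage_inj)
qed

lemma proper_idx_set_admissible: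
  assumes "A \<subseteq> idx_set m n" "A \<noteq> {}" "A \<noteq> idx_set m n"
    and "w \<in> weyl_group m n" "weyl_perm w ` A = idx_set p q"
  shows "admissible m n p q"
proof -
  note perm = weyl_perm_permutes[OF assms(4)]
  have "idx_set p q \<subseteq> idx_set m n"
    using assms(1,5) permutes_image[OF perm] by (metis image_mono)
  then have "Inl i \<in> idx_set m n" if "i \<in> {1..p}" for i
    using that subsetD[OF \<open>idx_set p q \<subseteq> idx_set m n\<close>, of "Inl i"] by auto
  moreover have "Inr k \<in> idx_set m n" if "k \<in> {1..q}" for k
    using that subsetD[OF \<open>idx_set p q \<subseteq> idx_set m n\<close>, of "Inr k"] by auto
  ultimately have "{1..p} \<subseteq> {1..m}" "{1..q} \<subseteq> {1..n}" by auto
  then have "p \<le> m" "q \<le> n" by auto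
  moreover have "idx_set p q \<noteq> idx_set m n"
    using assms(3,5) permutes_image[OF perm] inj_image_eq_iff[OF permutes_inj[OF perm]] by metis
  moreover have "idx_set p q \<noteq> {}" using assms(2,5) by auto
  ultimately show ?thesis by (auto simp: admissible_def idx_set_def)
qed

lemma admissible_proper:
  assumes "admissible m n p q"
  shows "idx_set p q \<subset> idx_set m n"
proof -
  have le: "p \<le> m" "q \<le> n" and ne: "p \<noteq> m \<or> q \<noteq> n"
    using assms by (auto simp: admissible_def)
  have "idx_set p q \<subseteq> idx_set m n" using le by (auto simp: idx_set_def)
  moreover have "Inl m \<notin> idx_set p q \<and> Inl m \<in> idx_set m n \<or> Inr n \<notin> idx_set p q \<and> Inr n \<in> idx_set m n"
    using le ne by auto
  ultimately show ?thesis by blast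
qed

lemma weyl_act_block_std_iff:
  assumes mn: "m \<noteq> n" and A: "A \<subset> idx_set m n" and w: "w \<in> weyl_group m n"
    and adm: "admissible m n p q"
  shows "weyl_act w ` block_parabolic m n A = std_parabolic m n p q \<longleftrightarrow> weyl_perm w ` A = idx_set p q"
proof -
  note perm = weyl_perm_permutes[OF w]
  have "weyl_perm w ` A \<subset> idx_set m n"
    using A permutes_image[OF perm] inj_image_subset_iff[OF permutes_inj[OF perm]]
    by (metis psubset_eq subset_antisym)
  then show ?thesis
    using block_parabolic_inj[OF mn] admissible_proper[OF adm]
    unfolding weyl_act_block[OF w] std_parabolic_block by metis
qed

text \<open>
  The numbers of even and of odd elements of \<open>A\<close> are a complete invariant of the orbit of \<open>A\<close>.
\<close>

lemma unique_standard_conjugate: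
  assumes mn: "m \<noteq> n" and A: "A \<subseteq> idx_set m n" "A \<noteq> {}" "A \<noteq> idx_set m n"
  shows "\<exists>!p. case p of (m0, n0) \<Rightarrow> admissible m n m0 n0 \<and>
    (\<exists>w\<in>weyl_group m n. weyl_act w ` block_parabolic m n A = std_parabolic m n m0 n0)"
proof (rule ex1I[of _ "(card (Inl -` A), card (Inr -` A))"])
  have A': "A \<subset> idx_set m n" using A by blast
  obtain w where w: "w \<in> weyl_group m n" "weyl_perm w ` A = idx_set (card (Inl -` A)) (card (Inr -` A))"
    using weyl_orbit_representative[OF A(1)] by blast
  moreover have "admissible m n (card (Inl -` A)) (card (Inr -` A))"
    using proper_idx_set_admissible[OF A w] .
  ultimately show "case (card (Inl -` A), card (Inr -` A)) of (m0, n0) \<Rightarrow> admissible m n m0 n0 \<and>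
    (\<exists>w\<in>weyl_group m n. weyl_act w ` block_parabolic m n A = std_parabolic m n m0 n0)"
    using weyl_act_block_std_iff[OF mn A'] by auto
  fix p assume "case p of (m0, n0) \<Rightarrow> admissible m n m0 n0 \<and>
    (\<exists>w\<in>weyl_group m n. weyl_act w ` block_parabolic m n A = std_parabolic m n m0 n0)"
  then show "p = (card (Inl -` A), card (Inr -` A))"
    using weyl_act_block_std_iff[OF mn A'] weyl_orbit_invariant[where A = A] by (cases p) auto
qed

section \<open>Isomorphisms, subalgebras and invariance of the supertrace\<close>

lemma lsa_restrict_simps [simp]:
  "lspace (lsa_restrict L S) = S" "even_part (lsa_restrict L S) = even_part L"
  "odd_part (lsa_restrict L S) = odd_part L" "lscale (lsa_restrict L S) = lscale L"
  "bracket (lsa_restrict L S) = bracket L" "lsa_restrict (lsa_restrict L S) T = lsa_restrict L T"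
  by (simp_all add: lsa_restrict_def)

lemma lsa_iso_restrict:
  assumes "lsa_iso L M \<phi>" "S \<subseteq> lspace L" "\<phi> ` S = T"
  shows "lsa_iso (lsa_restrict L S) (lsa_restrict M T) \<phi>"
proof -
  have "bij_betw \<phi> S T"
    using assms by (auto simp: lsa_iso_def intro: bij_betw_subset)
  then show ?thesis
    using assms(1) subsetD[OF assms(2)] by (simp add: lsa_iso_def)
qed

lemma lsa_iso_trans:
  assumes "lsa_iso L M \<phi>" "lsa_iso M N \<psi>"
  shows "lsa_iso L N (\<psi> \<circ> \<phi>)"
proof -
  have "\<phi> x \<in> lspace M" if "x \<in> lspace L" for x
    using that assms(1) by (auto simp: lsa_iso_def bij_betw_def)
  then show ?thesis
    using assms by (auto simp: lsa_iso_def intro: bij_betw_trans)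
qed

lemma supertrace_add: "supertrace m n (X + Y) = supertrace m n X + supertrace m n Y"
  by (simp add: supertrace_idx distrib_left sum.distrib)

lemma supertrace_scale: "supertrace m n (mat_scale c X) = c * supertrace m n X"
  by (simp add: supertrace_idx mat_scale_def sum_distrib_left algebra_simps)

lemma supertrace_diff: "supertrace m n (X - Y) = supertrace m n X - supertrace m n Y"
  by (simp add: supertrace_idx right_diff_distrib sum_subtractf)

lemma supertrace_sbracket: "supertrace m n (sbracket m n X Y) = 0"
proof -
  let ?I = "idx_set m n"
  have sign: "(-1) ^ par a * (-1) ^ ((par a + par c) * (par c + par a)) = ((-1) ^ par c :: complex)" for a c
    by (simp add: minus_one_power_iff)
  have "supertrace m n (sbracket m n X Y)
      = (\<Sum>a\<in>?I. \<Sum>c\<in>?I. (-1) ^ par a * (X a c * Y c a) - (-1) ^ par c * (Y a c * X c a))"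
    unfolding supertrace_idx sbracket_def sum_distrib_left right_diff_distrib
    by (simp add: sign flip: mult.assoc)
  also have "\<dots> = (\<Sum>a\<in>?I. \<Sum>c\<in>?I. (-1) ^ par a * (X a c * Y c a))
      - (\<Sum>a\<in>?I. \<Sum>c\<in>?I. (-1) ^ par c * (Y a c * X c a))"
    by (simp add: sum_subtractf)
  also have "(\<Sum>a\<in>?I. \<Sum>c\<in>?I. (-1) ^ par c * (Y a c * X c a))
      = (\<Sum>a\<in>?I. \<Sum>c\<in>?I. (-1) ^ par a * (X a c * Y c a))"
    by (subst sum.swap) (simp add: mult.commute)
  finally show ?thesis by simp
qed

lemma gl_zero:
  "X \<in> lspace (gl m n) \<Longrightarrow> a \<notin> idx_set m n \<Longrightarrow> X a b = 0"
  "X \<in> lspace (gl m n) \<Longrightarrow> b \<notin> idx_set m n \<Longrightarrow> X a b = 0"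
  by (auto simp: gl_space)

lemma gl_scale: "X \<in> lspace (gl m n) \<Longrightarrow> mat_scale c X \<in> lspace (gl m n)"
  by (auto simp: gl_space mat_scale_def)

lemma gl_closed:
  assumes "X \<in> lspace (gl m n)" "Y \<in> lspace (gl m n)"
  shows "X + Y \<in> lspace (gl m n)" "X - Y \<in> lspace (gl m n)"
    "sbracket m n X Y \<in> lspace (gl m n)"
proof -
  show "X + Y \<in> lspace (gl m n)" "X - Y \<in> lspace (gl m n)"
    using assms by (auto simp: gl_space) (metis add_0 diff_self)+
  have "sbracket m n X Y a b = 0" if "a \<notin> idx_set m n \<or> b \<notin> idx_set m n" for a b
    unfolding sbracket_def using assms that by (intro sum.neutral) (auto simp: gl_zero)
  then show "sbracket m n X Y \<in> lspace (gl m n)" by (auto simp: gl_space)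
qed

lemma sbracket_diff:
  "sbracket m n (X - Y) Z = sbracket m n X Z - sbracket m n Y Z"
  "sbracket m n Z (X - Y) = sbracket m n Z X - sbracket m n Z Y"
  by (simp_all add: fun_eq_iff sbracket_def algebra_simps sum_subtractf sum.distrib)

lemma sbracket_scale:
  "sbracket m n (mat_scale c X) Y = mat_scale c (sbracket m n X Y)"
  "sbracket m n X (mat_scale c Y) = mat_scale c (sbracket m n X Y)"
  by (simp_all add: fun_eq_iff sbracket_def mat_scale_def sum_distrib_left algebra_simps)

section \<open>Splitting off the centre of gl(p|q), p different from q\<close>

definition id_mat :: "nat \<Rightarrow> nat \<Rightarrow> smat" where
  "id_mat p q = (\<lambda>a b. if a = b \<and> a \<in> idx_set p q then 1 else 0)"

lemma id_mat_gl: "id_mat p q \<in> lspace (gl p q)"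
  by (auto simp: gl_space id_mat_def split: if_splits)

lemma supertrace_id_mat: "supertrace p q (id_mat p q) = of_nat p - of_nat q"
  by (simp add: supertrace_def id_mat_def)

lemma sbracket_id_mat:
  assumes "X \<in> lspace (gl p q)"
  shows "sbracket p q (id_mat p q) X = 0" "sbracket p q X (id_mat p q) = 0"
proof -
  have "\<forall>a b. id_mat p q a b \<noteq> 0 \<longrightarrow> a = b" by (simp add: id_mat_def)
  note * = sbracket_diagonal[OF this assms]
  have "(id_mat p q a a - id_mat p q b b) * X a b = 0" "(id_mat p q b b - id_mat p q a a) * X a b = 0" for a b
    using assms by (auto simp: gl_space id_mat_def)
  then show "sbracket p q (id_mat p q) X = 0" "sbracket p q X (id_mat p q) = 0"
    by (simp_all only: fun_eq_iff * zero_fun_apply simp_thms)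
qed

definition traceless :: "nat \<Rightarrow> nat \<Rightarrow> smat \<Rightarrow> smat" where
  "traceless p q X = X - mat_scale (supertrace p q X / (of_nat p - of_nat q)) (id_mat p q)"

lemma traceless_add: "traceless p q (X + Y) = traceless p q X + traceless p q Y"
  by (simp add: traceless_def supertrace_add fun_eq_iff mat_scale_def add_divide_distrib algebra_simps)

lemma traceless_scale: "traceless p q (mat_scale c X) = mat_scale c (traceless p q X)"
  unfolding traceless_def supertrace_scale by (simp add: fun_eq_iff mat_scale_def algebra_simps)

lemma traceless_sl:
  assumes "p \<noteq> q" "X \<in> lspace (gl p q)"
  shows "traceless p q X \<in> lspace (sl p q)"
  using assms by (simp add: sl_space traceless_def gl_closed gl_scale id_mat_gl supertrace_diff supertrace_scale
      supertrace_id_mat)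

lemma sbracket_traceless:
  assumes "X \<in> lspace (gl p q)" "Y \<in> lspace (gl p q)"
  shows "sbracket p q (traceless p q X) (traceless p q Y) = sbracket p q X Y"
proof -
  have [simp]: "mat_scale c 0 = 0" for c by (simp add: mat_scale_def fun_eq_iff)
  show ?thesis
    using assms by (simp add: traceless_def sbracket_diff sbracket_scale sbracket_id_mat id_mat_gl gl_closed gl_scale)
qed

lemma traceless_sbracket: "traceless p q (sbracket p q X Y) = sbracket p q X Y"
  by (simp add: traceless_def supertrace_sbracket fun_eq_iff mat_scale_def)

lemma homogeneous_traceless_even:
  "homogeneous_mat 0 (traceless p q X) \<longleftrightarrow> homogeneous_mat 0 X"
proof -
  have "(traceless p q X a b \<noteq> 0 \<longrightarrow> even (par a + par b)) \<longleftrightarrow> (X a b \<noteq> 0 \<longrightarrow> even (par a + par b))" for a b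
    by (cases "a = b") (simp_all add: traceless_def mat_scale_def id_mat_def)
  then show ?thesis by (simp add: homogeneous_mat_def)
qed

lemma supertrace_odd:
  assumes "homogeneous_mat 1 X"
  shows "supertrace p q X = 0"
proof -
  have "X a a = 0" for a using assms by (auto simp: homogeneous_mat_def)
  then show ?thesis by (simp add: supertrace_idx)
qed

lemma traceless_of_supertrace_zero: "supertrace p q X = 0 \<Longrightarrow> traceless p q X = X"
  by (simp add: traceless_def mat_scale_def fun_eq_iff)

lemma traceless_shift:
  assumes "p \<noteq> q" "X \<in> lspace (sl p q)"
  shows "traceless p q (X + mat_scale (s / (of_nat p - of_nat q)) (id_mat p q)) = X"
    and "supertrace p q (X + mat_scale (s / (of_nat p - of_nat q)) (id_mat p q)) = s"
proof -
  have 0: "of_nat p - of_nat q \<noteq> (0 :: complex)" using assms(1) by simp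
  show *: "supertrace p q (X + mat_scale (s / (of_nat p - of_nat q)) (id_mat p q)) = s"
    using assms 0 by (simp add: sl_space supertrace_add supertrace_scale supertrace_id_mat)
  show "traceless p q (X + mat_scale (s / (of_nat p - of_nat q)) (id_mat p q)) = X"
    unfolding traceless_def * by simp
qed

lemma lsa_sum_simps [simp]:
  "lspace (lsa_sum L M) = lspace L \<times> lspace M" "even_part (lsa_sum L M) = even_part L \<times> even_part M"
  "odd_part (lsa_sum L M) = odd_part L \<times> odd_part M"
  "lscale (lsa_sum L M) c (x, y) = (lscale L c x, lscale M c y)"
  "bracket (lsa_sum L M) (x, y) (x', y') = (bracket L x x', bracket M y y')"
  by (simp_all add: lsa_sum_def)

lemma lsa_C_simps [simp]:
  "lspace lsa_C = UNIV" "even_part lsa_C = UNIV" "odd_part lsa_C = {0}" "lscale lsa_C = (*)"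
  "bracket lsa_C x y = 0"
  by (simp_all add: lsa_C_def)

text \<open>
  For \<open>p \<noteq> q\<close> the algebra \<open>gl(p|q)\<close> is \<open>sl(p|q)\<close> plus the scalar matrices, the scalar part being measured by
  the supertrace. In a pair with opposite supertraces one number determines both scalar parts, which
  accounts for the single one-dimensional summand. That summand is even because odd matrices have
  supertrace zero.
\<close>

lemma split_centres_iso:
  assumes pq: "p \<noteq> q" "p' \<noteq> q'"
  shows "lsa_iso
    (lsa_restrict (lsa_sum (gl p q) (gl p' q'))
      {(X, Y) \<in> lspace (gl p q) \<times> lspace (gl p' q'). supertrace p q X + supertrace p' q' Y = 0})
    (lsa_sum (lsa_sum (sl p q) (sl p' q')) lsa_C)
    (\<lambda>(X, Y). ((traceless p q X, traceless p' q' Y), supertrace p q X))"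
    (is "lsa_iso (lsa_restrict ?L ?S) ?M ?\<phi>")
proof -
  define shift where "shift p q s X = X + mat_scale (s / (of_nat p - of_nat q)) (id_mat p q)"
    for p q :: nat and s :: complex and X :: smat
  have "bij_betw ?\<phi> ?S (lspace ?M)"
  proof (rule bij_betw_byWitness[where f' = "\<lambda>((X, Y), s). (shift p q s X, shift p' q' (- s) Y)"])
    have "shift p q (supertrace p q X) (traceless p q X) = X" for p q X
      by (simp add: shift_def traceless_def)
    moreover have "supertrace p' q' Y = - supertrace p q X" if "(X, Y) \<in> ?S" for X Y
      using that by (simp add: eq_neg_iff_add_eq_0 add.commute)
    ultimately show "\<forall>x\<in>?S. (\<lambda>((X, Y), s). (shift p q s X, shift p' q' (- s) Y)) (?\<phi> x) = x"
      by auto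
    show "\<forall>y\<in>lspace ?M. ?\<phi> ((\<lambda>((X, Y), s). (shift p q s X, shift p' q' (- s) Y)) y) = y"
      using traceless_shift[folded shift_def] pq by auto
    show "?\<phi> ` ?S \<subseteq> lspace ?M"
      using traceless_sl pq by auto
    show "(\<lambda>((X, Y), s). (shift p q s X, shift p' q' (- s) Y)) ` lspace ?M \<subseteq> ?S"
    proof (clarsimp, intro conjI)
      fix X Y s assume XY: "X \<in> lspace (sl p q)" "Y \<in> lspace (sl p' q')"
      then show "shift p q s X \<in> lspace (gl p q)" "shift p' q' (- s) Y \<in> lspace (gl p' q')"
        by (simp_all add: shift_def gl_closed gl_scale id_mat_gl sl_space)
      show "supertrace p q (shift p q s X) + supertrace p' q' (shift p' q' (- s) Y) = 0"
        using traceless_shift(2)[OF pq(1) XY(1), of s] traceless_shift(2)[OF pq(2) XY(2), of "- s"]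
        by (simp add: shift_def)
    qed
  qed
  moreover have "?\<phi> x \<in> odd_part ?M \<longleftrightarrow> x \<in> odd_part ?L" if "x \<in> ?S" for x
  proof -
    obtain X Y where x: "x = (X, Y)" by force
    have s: "supertrace p' q' Y = - supertrace p q X"
      using that by (simp add: x eq_neg_iff_add_eq_0 add.commute)
    show ?thesis
    proof (cases "supertrace p q X = 0")
      case True
      then show ?thesis using s by (simp add: x traceless_of_supertrace_zero)
    next
      case False
      then show ?thesis using supertrace_odd[of X p q] by (auto simp: x)
    qed
  qed
  ultimately show ?thesis
    by (auto simp: lsa_iso_def traceless_add traceless_scale supertrace_add supertrace_scale
        homogeneous_traceless_even sbracket_traceless traceless_sbracket supertrace_sbracket)
qed

section \<open>Submatrices of block diagonal matrices\<close>

definition submat :: "(idx \<Rightarrow> idx) \<Rightarrow> nat \<Rightarrow> nat \<Rightarrow> smat \<Rightarrow> smat" where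
  "submat f p q X = (\<lambda>a b. if a \<in> idx_set p q \<and> b \<in> idx_set p q then X (f a) (f b) else 0)"

lemma diag_block_weyl_conj:
  "diag_block r s p q (weyl_conj w X) = submat (inv (weyl_perm w) \<circ> map_sum ((+) r) ((+) s)) p q X"
  by (simp add: diag_block_def weyl_conj_def submat_def fun_eq_iff)

lemma submat_add: "submat f p q (X + Y) = submat f p q X + submat f p q Y"
  by (simp add: submat_def fun_eq_iff)

lemma submat_scale: "submat f p q (mat_scale c X) = mat_scale c (submat f p q X)"
  by (simp add: submat_def mat_scale_def fun_eq_iff)

lemma submat_gl: "submat f p q X \<in> lspace (gl p q)"
  by (simp add: submat_def gl_space)

text \<open>
  The enumerations \<open>f\<close> and \<open>g\<close> of the two blocks are arbitrary parity preserving bijections. Composing the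
  standard ones with the inverse of a Weyl group element reaches every parabolic set in the orbit
  directly, without transporting structures along the conjugation. The conditions are symmetric in the
  two blocks, so facts about the first block give those about the second by interchanging them.
\<close>

locale two_blocks =
  fixes m n p q p' q' :: nat and A B :: "idx set" and f g :: "idx \<Rightarrow> idx"
  assumes f: "bij_betw f (idx_set p q) A" and g: "bij_betw g (idx_set p' q') B"
    and disjoint: "A \<inter> B = {}" and cover: "A \<union> B = idx_set m n"
    and par_f [simp]: "\<And>a. par (f a) = par a" and par_g [simp]: "\<And>a. par (g a) = par a"
begin

lemma swap_blocks: "two_blocks m n p' q' p q B A g f"
  using f g disjoint cover par_f par_g by (unfold_locales) auto

definition block_diagonal :: "smat set" where
  "block_diagonal = {X. \<forall>a b. X a b \<noteq> 0 \<longrightarrow> a \<in> A \<and> b \<in> A \<or> a \<in> B \<and> b \<in> B}"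

lemma f_in: "a \<in> idx_set p q \<Longrightarrow> f a \<in> A"
  using f by (auto simp: bij_betw_def)

lemma g_in: "a \<in> idx_set p' q' \<Longrightarrow> g a \<in> B"
  using g by (auto simp: bij_betw_def)

lemma finite_A: "finite A" and finite_B: "finite B"
  using cover finite_idx_set[of m n] by (metis finite_Un)+

lemma block_diagonal_gl: "X \<in> block_diagonal \<Longrightarrow> X \<in> lspace (gl m n)"
  using cover by (auto simp: block_diagonal_def gl_space)

lemma sum_over_A:
  assumes "\<And>c. c \<in> B \<Longrightarrow> h c = 0"
  shows "(\<Sum>c\<in>idx_set m n. h c) = (\<Sum>c\<in>idx_set p q. h (f c))"
proof -
  have "(\<Sum>c\<in>idx_set m n. h c) = (\<Sum>c\<in>A. h c)"
    using assms cover by (intro sum.mono_neutral_right) auto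
  then show ?thesis by (simp add: sum.reindex_bij_betw[OF f])
qed

lemma block_diagonal_zero:
  assumes "X \<in> block_diagonal" "a \<in> A" "b \<in> B"
  shows "X a b = 0" "X b a = 0"
  using assms disjoint unfolding block_diagonal_def by blast+

lemma submat_sbracket:
  assumes X: "X \<in> block_diagonal" and Y: "Y \<in> block_diagonal"
  shows "submat f p q (sbracket m n X Y) = sbracket p q (submat f p q X) (submat f p q Y)"
proof (intro ext)
  fix a b
  show "submat f p q (sbracket m n X Y) a b = sbracket p q (submat f p q X) (submat f p q Y) a b"
  proof (cases "a \<in> idx_set p q \<and> b \<in> idx_set p q")
    case True
    have "X (f a) c = 0" "Y (f a) c = 0" if "c \<in> B" for c
      using X Y that True f_in[of a] by (simp_all add: block_diagonal_zero)
    then show ?thesis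
      using True by (auto simp: submat_def sbracket_def sum_over_A intro!: sum.cong)
  next
    case False
    then show ?thesis by (auto simp: submat_def sbracket_def)
  qed
qed

lemma supertrace_submat: "supertrace p q (submat f p q X) = (\<Sum>a\<in>A. (-1) ^ par a * X a a)"
  by (simp add: supertrace_idx submat_def flip: sum.reindex_bij_betw[OF f])

lemma supertrace_blocks:
  "supertrace m n X = supertrace p q (submat f p q X) + supertrace p' q' (submat g p' q' X)"
  unfolding supertrace_submat two_blocks.supertrace_submat[OF swap_blocks]
  by (simp add: supertrace_idx sum.union_disjoint[OF finite_A finite_B disjoint] flip: cover)

lemma block_diagonal_closed:
  assumes "X \<in> block_diagonal" "Y \<in> block_diagonal"
  shows "X + Y \<in> block_diagonal" "mat_scale c X \<in> block_diagonal" "sbracket m n X Y \<in> block_diagonal"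
proof -
  show "X + Y \<in> block_diagonal" "mat_scale c X \<in> block_diagonal"
    using assms by (auto simp: block_diagonal_def mat_scale_def) (metis add_0)+
  have "sbracket m n X Y a b = 0" if "\<not> (a \<in> A \<and> b \<in> A \<or> a \<in> B \<and> b \<in> B)" for a b
  proof -
    have "X a c * Y c b = 0" "Y a c * X c b = 0" for c
      using assms that disjoint by (simp_all add: block_diagonal_def) (metis disjoint_iff)+
    then show ?thesis
      unfolding sbracket_def by (simp only: mult_zero_right diff_zero sum.neutral_const)
  qed
  then show "sbracket m n X Y \<in> block_diagonal" by (auto simp: block_diagonal_def)
qed

definition blocks :: "smat \<Rightarrow> smat \<times> smat" where
  "blocks X = (submat f p q X, submat g p' q' X)"

definition unblocks :: "smat \<times> smat \<Rightarrow> smat" where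
  "unblocks = (\<lambda>(Y, Z) a b.
     if a \<in> A \<and> b \<in> A then Y (inv_into (idx_set p q) f a) (inv_into (idx_set p q) f b)
     else if a \<in> B \<and> b \<in> B then Z (inv_into (idx_set p' q') g a) (inv_into (idx_set p' q') g b)
     else 0)"

lemma bij_blocks:
  "bij_betw blocks block_diagonal (lspace (gl p q) \<times> lspace (gl p' q'))"
proof (rule bij_betw_byWitness[where f' = unblocks])
  have fi: "f (inv_into (idx_set p q) f a) = a" "inv_into (idx_set p q) f a \<in> idx_set p q" if "a \<in> A" for a
    using f that by (auto simp: bij_betw_def f_inv_into_f inv_into_into)
  have gi: "g (inv_into (idx_set p' q') g a) = a" "inv_into (idx_set p' q') g a \<in> idx_set p' q'" if "a \<in> B" for a
    using g that by (auto simp: bij_betw_def f_inv_into_f inv_into_into)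
  have if': "inv_into (idx_set p q) f (f a) = a" if "a \<in> idx_set p q" for a
    using f that by (simp add: bij_betw_def)
  have ig: "inv_into (idx_set p' q') g (g a) = a" if "a \<in> idx_set p' q'" for a
    using g that by (simp add: bij_betw_def)
  have nB: "g a \<notin> A" if "a \<in> idx_set p' q'" for a
    using g_in[OF that] disjoint by blast
  show "\<forall>X\<in>block_diagonal. unblocks (blocks X) = X"
    by (auto simp: fun_eq_iff unblocks_def blocks_def submat_def fi gi block_diagonal_def)
  show "\<forall>Y\<in>lspace (gl p q) \<times> lspace (gl p' q'). blocks (unblocks Y) = Y"
    using f_in g_in nB by (auto simp: fun_eq_iff unblocks_def blocks_def submat_def if' ig gl_zero)
  show "blocks ` block_diagonal \<subseteq> lspace (gl p q) \<times> lspace (gl p' q')"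
    by (auto simp: blocks_def submat_gl)
  show "unblocks ` (lspace (gl p q) \<times> lspace (gl p' q')) \<subseteq> block_diagonal"
    by (auto simp: unblocks_def block_diagonal_def split: if_splits)
qed

lemma homogeneous_blocks:
  assumes "X \<in> block_diagonal"
  shows "homogeneous_mat k X \<longleftrightarrow>
    homogeneous_mat k (submat f p q X) \<and> homogeneous_mat k (submat g p' q' X)"
proof
  assume "homogeneous_mat k X"
  then have "even (par a + par b) \<longleftrightarrow> even k" if "X a b \<noteq> 0" for a b
    using that unfolding homogeneous_mat_def by blast
  from this[of "f _" "f _"] this[of "g _" "g _"]
  show "homogeneous_mat k (submat f p q X) \<and> homogeneous_mat k (submat g p' q' X)"
    by (simp add: homogeneous_mat_def submat_def)
next
  assume *: "homogeneous_mat k (submat f p q X) \<and> homogeneous_mat k (submat g p' q' X)"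
  show "homogeneous_mat k X"
    unfolding homogeneous_mat_def
  proof (intro allI impI)
    fix a b assume ab: "X a b \<noteq> 0"
    with assms consider "a \<in> A" "b \<in> A" | "a \<in> B" "b \<in> B" by (auto simp: block_diagonal_def)
    then show "even (par a + par b) \<longleftrightarrow> even k"
    proof cases
      case 1
      then obtain c d where cd: "a = f c" "b = f d" "c \<in> idx_set p q" "d \<in> idx_set p q"
        using f by (auto simp: bij_betw_def)
      then have "submat f p q X c d \<noteq> 0" using ab by (simp add: submat_def)
      then show ?thesis using * cd by (auto simp: homogeneous_mat_def)
    next
      case 2
      then obtain c d where cd: "a = g c" "b = g d" "c \<in> idx_set p' q'" "d \<in> idx_set p' q'"
        using g by (auto simp: bij_betw_def)
      then have "submat g p' q' X c d \<noteq> 0" using ab by (simp add: submat_def)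
      then show ?thesis using * cd by (auto simp: homogeneous_mat_def)
    qed
  qed
qed

lemma block_diagonal_swap: "two_blocks.block_diagonal B A = block_diagonal"
  unfolding two_blocks.block_diagonal_def[OF swap_blocks] block_diagonal_def by blast

lemma blocks_iso:
  "lsa_iso (lsa_restrict (gl m n) block_diagonal) (lsa_sum (gl p q) (gl p' q')) blocks"
  using bij_blocks two_blocks.submat_sbracket[OF swap_blocks] submat_sbracket
  by (auto simp: lsa_iso_def blocks_def submat_add submat_scale homogeneous_blocks block_diagonal_swap)

end

section \<open>The Levi subalgebra\<close>

lemma lspace_levi_block:
  assumes mn: "m \<noteq> n" and A: "A \<subseteq> idx_set m n"
  shows "lspace (levi_subalgebra m n (block_parabolic m n A)) =
    {X \<in> lspace (gl m n). supertrace m n X = 0 \<and> (\<forall>a b. X a b \<noteq> 0 \<longrightarrow> (a \<in> A \<longleftrightarrow> b \<in> A))}"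
    (is "_ = ?R")
proof -
  let ?K = "{(a, b) \<in> offdiag m n. a \<in> A \<longleftrightarrow> b \<in> A}"
  have "?K \<subseteq> offdiag m n" by auto
  note rs = root_space_sum_iff[OF mn this]
  have "{H + X | H X. H \<in> cartan m n \<and> X \<in> root_space_sum m n (pair_root m n ` ?K)} = ?R"
  proof (intro equalityI subsetI)
    fix Z assume "Z \<in> {H + X | H X. H \<in> cartan m n \<and> X \<in> root_space_sum m n (pair_root m n ` ?K)}"
    then obtain H X where Z: "Z = H + X" and H: "H \<in> cartan m n"
      and X: "\<forall>a b. X a b \<noteq> 0 \<longrightarrow> (a, b) \<in> ?K"
      by (auto simp: rs)
    have "X a a = 0" for a using X by (auto simp: offdiag_def)
    then have "supertrace m n Z = 0"
      using H by (simp add: Z supertrace_add cartan_iff) (simp add: supertrace_idx)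
    moreover have "a \<in> idx_set m n \<and> b \<in> idx_set m n \<and> (a \<in> A \<longleftrightarrow> b \<in> A)" if "Z a b \<noteq> 0" for a b
    proof -
      have "H a b \<noteq> 0 \<or> X a b \<noteq> 0" using that by (auto simp: Z)
      then show ?thesis using H X by (auto simp: cartan_iff offdiag_def)
    qed
    ultimately show "Z \<in> ?R" by (simp add: gl_space)
  next
    fix Z assume Z: "Z \<in> ?R"
    define H where "H = (\<lambda>a b. if a = b then Z a b else 0)"
    have "supertrace m n H = supertrace m n Z" by (simp add: H_def supertrace_def)
    then have "H \<in> cartan m n" using Z by (auto simp: cartan_iff H_def gl_space split: if_splits)
    moreover have "Z - H \<in> root_space_sum m n (pair_root m n ` ?K)"
      unfolding rs using Z by (auto simp: H_def gl_space offdiag_def split: if_splits)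
    moreover have "Z = H + (Z - H)" by simp
    ultimately show "Z \<in> {H + X | H X. H \<in> cartan m n \<and> X \<in> root_space_sum m n (pair_root m n ` ?K)}"
      by blast
  qed
  then show ?thesis
    by (simp add: levi_subalgebra_def levi_component_block[OF mn])
qed

lemma levi_restrict_gl:
  "levi_subalgebra m n P = lsa_restrict (gl m n) (lspace (levi_subalgebra m n P))"
  by (simp add: levi_subalgebra_def sl_def)

definition even_component :: "smat \<Rightarrow> smat" where
  "even_component X = (\<lambda>a b. if even (par a + par b) then X a b else 0)"

lemma homogeneous_components:
  "homogeneous_mat 0 (even_component X)" "homogeneous_mat 1 (X - even_component X)"
  by (auto simp: homogeneous_mat_def even_component_def split: if_splits)

context two_blocks
begin

definition levi_space :: "smat set" where
  "levi_space = {X \<in> block_diagonal. supertrace m n X = 0}"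

definition sl_blocks :: "smat set" where
  "sl_blocks = {X \<in> block_diagonal.
     supertrace p q (submat f p q X) = 0 \<and> supertrace p' q' (submat g p' q' X) = 0}"

lemma lspace_levi:
  assumes "m \<noteq> n"
  shows "lspace (levi_subalgebra m n (block_parabolic m n A)) = levi_space"
proof -
  have "A \<subseteq> idx_set m n" using cover by blast
  moreover have "X \<in> block_diagonal \<longleftrightarrow> X \<in> lspace (gl m n) \<and> (\<forall>a b. X a b \<noteq> 0 \<longrightarrow> (a \<in> A \<longleftrightarrow> b \<in> A))" for X
    unfolding block_diagonal_def gl_space cover[symmetric] using disjoint by blast
  ultimately show ?thesis
    using lspace_levi_block[OF assms] unfolding levi_space_def by blast
qed

lemma levi_eq:
  assumes "m \<noteq> n"
  shows "levi_subalgebra m n (block_parabolic m n A) = lsa_restrict (gl m n) levi_space"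
  using levi_restrict_gl lspace_levi[OF assms] by metis

lemma levi_direct_sum:
  assumes mn: "m \<noteq> n" and pq: "p \<noteq> q" "p' \<noteq> q'"
  shows "lsa_isomorphic (levi_subalgebra m n (block_parabolic m n A))
    (lsa_sum (lsa_sum (sl p q) (sl p' q')) lsa_C)"
proof -
  let ?T = "{(X, Y) \<in> lspace (gl p q) \<times> lspace (gl p' q'). supertrace p q X + supertrace p' q' Y = 0}"
  have "blocks ` levi_space = ?T"
  proof (intro equalityI subsetI)
    fix Z assume "Z \<in> blocks ` levi_space"
    then show "Z \<in> ?T" by (auto simp: levi_space_def blocks_def submat_gl supertrace_blocks)
  next
    fix Z assume Z: "Z \<in> ?T"
    then have "Z \<in> blocks ` block_diagonal" using bij_blocks by (auto simp: bij_betw_def)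
    then show "Z \<in> blocks ` levi_space"
      using Z by (auto simp: levi_space_def blocks_def supertrace_blocks)
  qed
  then have "lsa_iso (lsa_restrict (gl m n) levi_space) (lsa_restrict (lsa_sum (gl p q) (gl p' q')) ?T) blocks"
    using lsa_iso_restrict[OF blocks_iso, of levi_space] by (simp add: levi_space_def)
  then show ?thesis
    unfolding levi_eq[OF mn] lsa_isomorphic_def
    using lsa_iso_trans split_centres_iso[OF pq] by blast
qed

lemma sl_blocks_iso:
  "lsa_iso (lsa_restrict (gl m n) sl_blocks) (lsa_sum (sl p q) (sl p' q')) blocks"
proof -
  have "blocks ` sl_blocks = lspace (sl p q) \<times> lspace (sl p' q')"
  proof (intro equalityI subsetI)
    fix Z assume "Z \<in> blocks ` sl_blocks"
    then show "Z \<in> lspace (sl p q) \<times> lspace (sl p' q')"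
      by (auto simp: sl_blocks_def blocks_def submat_gl sl_space)
  next
    fix Z assume Z: "Z \<in> lspace (sl p q) \<times> lspace (sl p' q')"
    then have "Z \<in> blocks ` block_diagonal" using bij_blocks by (auto simp: bij_betw_def sl_space)
    then show "Z \<in> blocks ` sl_blocks"
      using Z by (auto simp: sl_blocks_def blocks_def sl_space)
  qed
  moreover have "lsa_restrict (lsa_sum (gl p q) (gl p' q')) (lspace (sl p q) \<times> lspace (sl p' q'))
      = lsa_sum (sl p q) (sl p' q')"
    by (simp add: lsa_restrict_def lsa_sum_def)
  ultimately show ?thesis
    using lsa_iso_restrict[OF blocks_iso, of sl_blocks] by (simp add: sl_blocks_def)
qed

lemma block_diagonal_components:
  assumes "X \<in> block_diagonal"
  shows "even_component X \<in> block_diagonal" "X - even_component X \<in> block_diagonal"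
  using assms by (auto simp: block_diagonal_def even_component_def split: if_splits)

lemma sl_blocks_subset: "sl_blocks \<subseteq> levi_space"
  by (auto simp: sl_blocks_def levi_space_def supertrace_blocks)

text \<open>
  The even component of a matrix has the same diagonal and the odd component has zero diagonal, so
  conditions on supertraces define graded subspaces.
\<close>

lemma sl_blocks_components:
  assumes "X \<in> sl_blocks"
  shows "even_component X \<in> sl_blocks" "X - even_component X \<in> sl_blocks"
proof -
  have "supertrace p q (submat f p q (even_component X)) = supertrace p q (submat f p q X)"
    "supertrace p' q' (submat g p' q' (even_component X)) = supertrace p' q' (submat g p' q' X)"
    "supertrace p q (submat f p q (X - even_component X)) = 0"
    "supertrace p' q' (submat g p' q' (X - even_component X)) = 0"
    by (simp_all add: supertrace_idx submat_def even_component_def)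
  then show "even_component X \<in> sl_blocks" "X - even_component X \<in> sl_blocks"
    using assms by (simp_all add: sl_blocks_def block_diagonal_components)
qed

text \<open>Each block of a bracket is a bracket of blocks, and brackets have supertrace zero.\<close>

lemma sbracket_sl_blocks:
  assumes "X \<in> block_diagonal" "Y \<in> block_diagonal"
  shows "sbracket m n X Y \<in> sl_blocks"
proof -
  have "submat g p' q' (sbracket m n X Y) = sbracket p' q' (submat g p' q' X) (submat g p' q' Y)"
    using two_blocks.submat_sbracket[OF swap_blocks] assms by (simp add: block_diagonal_swap)
  then show ?thesis
    using assms by (simp add: sl_blocks_def block_diagonal_closed submat_sbracket supertrace_sbracket)
qed

lemma sl_blocks_ideal:
  "lsa_ideal (lsa_restrict (gl m n) levi_space) sl_blocks"
proof -
  have bd: "X \<in> block_diagonal" if "X \<in> sl_blocks \<or> X \<in> levi_space" for X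
    using that by (auto simp: sl_blocks_def levi_space_def)
  have zero: "0 \<in> sl_blocks"
    by (simp add: sl_blocks_def block_diagonal_def supertrace_submat
        two_blocks.supertrace_submat[OF swap_blocks])
  have add: "X + Y \<in> sl_blocks" if "X \<in> sl_blocks" "Y \<in> sl_blocks" for X Y
    using that by (simp add: sl_blocks_def block_diagonal_closed submat_add supertrace_add)
  have scale: "mat_scale c X \<in> sl_blocks" if "X \<in> sl_blocks" for c X
    using that block_diagonal_closed(2)[of X X]
    by (simp add: sl_blocks_def submat_scale supertrace_scale)
  have graded: "\<exists>y\<in>sl_blocks \<inter> {A. homogeneous_mat 0 A}. \<exists>z\<in>sl_blocks \<inter> {A. homogeneous_mat 1 A}. X = y + z"
    if "X \<in> sl_blocks" for X
    using sl_blocks_components[OF that] homogeneous_components[of X]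
    by (intro bexI[of _ "even_component X"] bexI[of _ "X - even_component X"]) auto
  show ?thesis
    using sl_blocks_subset zero add scale graded sbracket_sl_blocks bd
    by (simp add: lsa_ideal_def lsa_subspace_def)
qed

text \<open>
  The signs cancel those in the supertrace: a diagonal unit from each block, normalised so that the two
  block supertraces are \<open>1\<close> and \<open>-1\<close>.
\<close>

definition levi_toral :: "idx \<Rightarrow> idx \<Rightarrow> smat" where
  "levi_toral a b = mat_scale ((-1) ^ par a) (mat_unit a a) - mat_scale ((-1) ^ par b) (mat_unit b b)"

lemma levi_toral:
  assumes "a \<in> A" "b \<in> B"
  shows "levi_toral a b \<in> levi_space" "supertrace p q (submat f p q (levi_toral a b)) = 1"
proof -
  have D: "levi_toral a b c c = (if c = a then (-1) ^ par a else if c = b then - ((-1) ^ par b) else 0)" for c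
    using assms disjoint by (auto simp: levi_toral_def mat_scale_def mat_unit_def)
  have sq: "(-1) ^ par c * (-1) ^ par c = (1 :: complex)" for c
    by (simp add: minus_one_power_iff)
  have "supertrace p q (submat f p q (levi_toral a b)) = (\<Sum>c\<in>A. if c = a then 1 else 0)"
    unfolding supertrace_submat using assms disjoint by (intro sum.cong) (auto simp: D sq)
  then show 1: "supertrace p q (submat f p q (levi_toral a b)) = 1"
    using assms finite_A by simp
  have "supertrace p' q' (submat g p' q' (levi_toral a b)) = (\<Sum>c\<in>B. if c = b then - 1 else 0)"
    unfolding two_blocks.supertrace_submat[OF swap_blocks]
    using assms disjoint by (intro sum.cong) (auto simp: D sq)
  then have "supertrace m n (levi_toral a b) = 0"
    using 1 assms finite_B by (simp add: supertrace_blocks)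
  moreover have "levi_toral a b \<in> block_diagonal"
    using assms by (auto simp: block_diagonal_def levi_toral_def mat_scale_def mat_unit_def split: if_splits)
  ultimately show "levi_toral a b \<in> levi_space" by (simp add: levi_space_def)
qed

text \<open>
  The supertrace of the first block is a linear functional on the Levi subalgebra that vanishes
  exactly on the ideal and takes the value \<open>1\<close> on \<open>levi_toral a b\<close>. It therefore splits off the line of
  this matrix and identifies that line with the complex numbers.
\<close>

lemma levi_semidirect_sum:
  assumes mn: "m \<noteq> n" and ne: "A \<noteq> {}" "B \<noteq> {}"
  shows "\<exists>S T. semidirect_sum (levi_subalgebra m n (block_parabolic m n A)) S T \<and>
    lsa_isomorphic (lsa_restrict (levi_subalgebra m n (block_parabolic m n A)) S)
      (lsa_sum (sl p q) (sl p' q')) \<and>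
    lsa_isomorphic (lsa_restrict (levi_subalgebra m n (block_parabolic m n A)) T) lsa_C"
proof -
  obtain a b where ab: "a \<in> A" "b \<in> B" using ne by blast
  define D where "D = levi_toral a b"
  define str where "str X = supertrace p q (submat f p q X)" for X
  define T where "T = range (\<lambda>c. mat_scale c D)"
  note D = levi_toral[OF ab, folded D_def]
  have D_bd: "D \<in> block_diagonal" using D(1) by (simp add: levi_space_def)
  have str_D: "str (mat_scale c D) = c" for c
    using D(2) by (simp add: str_def submat_scale supertrace_scale)
  have "supertrace p' q' (submat g p' q' D) = - 1"
    using D supertrace_blocks[of D] by (simp add: levi_space_def eq_neg_iff_add_eq_0 add.commute)
  then have str_D': "supertrace p' q' (submat g p' q' (mat_scale c D)) = - c" for c
    by (simp add: submat_scale supertrace_scale)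
  have D_diag: "c \<noteq> d \<Longrightarrow> D c d = 0" for c d
    by (auto simp: D_def levi_toral_def mat_scale_def mat_unit_def)
  have D_even: "homogeneous_mat 0 (mat_scale c D)" for c
    using D_diag by (auto simp: homogeneous_mat_def mat_scale_def) (metis even_add)+
  have D_odd: "homogeneous_mat 1 (mat_scale c D) \<longleftrightarrow> c = 0" for c
  proof
    assume "homogeneous_mat 1 (mat_scale c D)"
    moreover have "homogeneous_mat 1 (submat f p q (mat_scale c D))"
      using calculation homogeneous_blocks[of "mat_scale c D"] block_diagonal_closed(2)[OF D_bd D_bd] by blast
    ultimately show "c = 0" using str_D[of c] supertrace_odd by (metis str_def)
  qed (simp add: homogeneous_mat_def mat_scale_def)
  have scale_scale: "mat_scale c (mat_scale d X) = mat_scale (c * d) X" for c d X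
    by (simp add: mat_scale_def fun_eq_iff)
  have scale_add: "mat_scale (c + d) X = mat_scale c X + mat_scale d X" for c d X
    by (simp add: mat_scale_def fun_eq_iff distrib_right)
  have scale_0: "mat_scale 0 X = 0" for X by (simp add: mat_scale_def fun_eq_iff)
  have T_levi: "T \<subseteq> levi_space"
    using D(1) block_diagonal_closed(2)[OF D_bd D_bd]
    by (auto simp: T_def levi_space_def supertrace_scale)
  have T_bracket: "sbracket m n (mat_scale c D) (mat_scale d D) = 0" for c d
  proof (intro ext)
    fix u v
    show "sbracket m n (mat_scale c D) (mat_scale d D) u v = 0 u v"
      using D_diag sbracket_diagonal(1)[of "mat_scale c D" "mat_scale d D" m n u v]
        block_diagonal_gl[OF block_diagonal_closed(2)[OF D_bd D_bd]]
      by (cases "u = v") (auto simp: mat_scale_def)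
  qed
  have T_sub: "lsa_subalgebra (lsa_restrict (gl m n) levi_space) T"
  proof -
    have zero: "0 \<in> T" unfolding T_def by (rule range_eqI[of _ _ 0]) (simp add: scale_0)
    have "x + y \<in> T" "mat_scale c x \<in> T" "sbracket m n x y \<in> T" if "x \<in> T" "y \<in> T" for x y c
      using that zero by (auto simp: T_def T_bracket scale_scale simp flip: scale_add)
    moreover have "\<exists>y\<in>T \<inter> {A. homogeneous_mat 0 A}. \<exists>z\<in>T \<inter> {A. homogeneous_mat 1 A}. x = y + z" if "x \<in> T" for x
      using that zero D_even
      by (intro bexI[of _ x] bexI[of _ 0]) (auto simp: T_def homogeneous_mat_def)
    ultimately show ?thesis using T_levi zero by (simp add: lsa_subalgebra_def lsa_subspace_def)
  qed
  have inter: "sl_blocks \<inter> T = {0}"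
  proof -
    have "x = 0" if "x \<in> sl_blocks" "x \<in> T" for x
      using that str_D by (auto simp: T_def sl_blocks_def str_def[symmetric] scale_0)
    moreover have "0 \<in> sl_blocks" "0 \<in> T"
      using sl_blocks_ideal T_sub by (auto simp: lsa_ideal_def lsa_subalgebra_def lsa_subspace_def)
    ultimately show ?thesis by blast
  qed
  have sum: "levi_space = {s + t | s t. s \<in> sl_blocks \<and> t \<in> T}"
  proof (intro equalityI subsetI)
    fix X assume X: "X \<in> levi_space"
    define Y where "Y = X + mat_scale (- str X) D"
    have "Y \<in> block_diagonal"
      using X D_bd block_diagonal_closed(1)[OF _ block_diagonal_closed(2)[OF D_bd D_bd]]
      by (simp add: Y_def levi_space_def)
    moreover have "str Y = 0"
      using str_D[of "- str X"] by (simp add: Y_def str_def submat_add supertrace_add)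
    moreover have "supertrace p' q' (submat g p' q' Y) = 0"
      using X str_D'[of "- str X"]
      by (simp add: Y_def submat_add supertrace_add levi_space_def supertrace_blocks str_def add.commute)
    ultimately have "Y \<in> sl_blocks" by (simp add: sl_blocks_def str_def)
    moreover have "X = Y + mat_scale (str X) D"
      by (simp add: Y_def fun_eq_iff mat_scale_def)
    ultimately show "X \<in> {s + t | s t. s \<in> sl_blocks \<and> t \<in> T}" by (auto simp: T_def)
  next
    fix X assume "X \<in> {s + t | s t. s \<in> sl_blocks \<and> t \<in> T}"
    then obtain s t where "X = s + t" "s \<in> levi_space" "t \<in> levi_space"
      using T_levi sl_blocks_subset by blast
    then show "X \<in> levi_space" by (simp add: levi_space_def block_diagonal_closed supertrace_add)
  qed
  have "bij_betw str T UNIV"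
    by (rule bij_betw_byWitness[where f' = "\<lambda>c. mat_scale c D"]) (auto simp: T_def str_D)
  then have "lsa_iso (lsa_restrict (gl m n) T) lsa_C str"
    using D_even D_odd T_bracket str_D[of 0, unfolded scale_0] by (auto simp: lsa_iso_def T_def str_D scale_scale simp flip: scale_add)
  then show ?thesis
    unfolding levi_eq[OF mn] lsa_isomorphic_def semidirect_sum_def
    using sl_blocks_ideal T_sub inter sum sl_blocks_iso
    by (intro exI[of _ sl_blocks] exI[of _ T]) auto
qed

section \<open>The nilradical as a module\<close>

lemma nilradical_block:
  assumes mn: "m \<noteq> n"
  shows "X \<in> nilradical m n (block_parabolic m n A) \<longleftrightarrow> (\<forall>a b. X a b \<noteq> 0 \<longrightarrow> a \<in> A \<and> b \<in> B)"
proof -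
  have A: "A \<subseteq> idx_set m n" and B: "idx_set m n - A = B" using cover disjoint by blast+
  have "A \<times> B \<subseteq> offdiag m n" using cover disjoint by (auto simp: offdiag_def)
  from root_space_sum_iff[OF mn this] show ?thesis
    by (simp add: nilradical_def nil_component_block[OF mn A] B)
qed

lemma sum_tensor_entries:
  assumes "finite C" "finite D" "a \<in> C" "b \<in> D"
  shows "(\<Sum>(c, d)\<in>C \<times> D. ((if b = d then F c else 0) + (if a = c then G d else 0)) * v (c, d))
    = (\<Sum>c\<in>C. F c * v (c, b)) + (\<Sum>d\<in>D. G d * (v (a, d) :: complex))"
proof -
  have "(\<Sum>(c, d)\<in>C \<times> D. ((if b = d then F c else 0) + (if a = c then G d else 0)) * v (c, d))
      = (\<Sum>c\<in>C. \<Sum>d\<in>D. (if b = d then F c * v (c, d) else 0))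
      + (\<Sum>c\<in>C. \<Sum>d\<in>D. (if a = c then G d * v (c, d) else 0))"
    unfolding sum.cartesian_product[symmetric] sum.distrib[symmetric]
    by (intro sum.cong) (auto simp: distrib_right)
  also have "(\<Sum>c\<in>C. \<Sum>d\<in>D. (if b = d then F c * v (c, d) else 0)) = (\<Sum>c\<in>C. F c * v (c, b))"
    using assms by simp
  also have "(\<Sum>c\<in>C. \<Sum>d\<in>D. (if a = c then G d * v (c, d) else 0)) = (\<Sum>d\<in>D. G d * v (a, d))"
    using assms by (subst sum.swap) simp
  finally show ?thesis .
qed

definition nil_coords :: "smat \<Rightarrow> idx \<times> idx \<Rightarrow> complex" where
  "nil_coords X = (\<lambda>(a, b). if a \<in> idx_set p q \<and> b \<in> idx_set p' q' then X (f a) (g b) else 0)"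

abbreviation nil_rep :: "(smat, idx \<times> idx) super_rep" where
  "nil_rep \<equiv> rep_tensor (rep_pullback (submat f p q) (std_rep p q))
     (rep_dual (rep_pullback (submat g p' q') (std_rep p' q')))"

text \<open>
  In \<open>[x, X]\<close> the product \<open>x X\<close> only involves the first block of \<open>x\<close>, acting on the row index, and \<open>X x\<close> only
  its second block, acting on the column index. The sign in front of the second term has exponent
  \<open>(|a| + |d|)(|d| + |b|) = (|b| + |d|)|a| + (|b| + |d|)|d|\<close>: the first summand is the sign for moving \<open>x\<close> past
  the vector \<open>e\<^sub>a\<close> in a tensor product, the second is the sign of the dual action. So the matrix entries
  themselves serve as coordinates, with no sign correction.
\<close>

lemma sbracket_nil:
  assumes x: "x \<in> block_diagonal" and X: "\<forall>a b. X a b \<noteq> 0 \<longrightarrow> a \<in> A \<and> b \<in> B"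
  shows "nil_coords (sbracket m n x X) = act (rep_module nil_rep) x (nil_coords X)"
proof
  fix ab :: "idx \<times> idx"
  obtain a b where ab: "ab = (a, b)" by force
  show "nil_coords (sbracket m n x X) ab = act (rep_module nil_rep) x (nil_coords X) ab"
  proof (cases "a \<in> idx_set p q \<and> b \<in> idx_set p' q'")
    case False
    then show ?thesis
      by (auto simp: ab nil_coords_def rep_module_def rep_tensor_def rep_pullback_def rep_dual_def std_rep_def)
  next
    case True
    let ?s = "\<lambda>d. (-1) ^ ((par a + par d) * (par d + par b)) :: complex"
    have sign: "?s d = (-1) ^ ((par b + par d) * par a) * (-1) ^ ((par b + par d) * par d)" for d
      by (simp add: algebra_simps flip: power_add)
    have fa: "f a \<in> A" and gb: "g b \<in> B" using True f_in g_in by auto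
    have "sbracket m n x X (f a) (g b)
        = (\<Sum>c\<in>idx_set m n. x (f a) c * X c (g b))
        - (\<Sum>c\<in>idx_set m n. (-1) ^ ((par a + par c) * (par c + par b)) * (X (f a) c * x c (g b)))"
      by (simp add: sbracket_def sum_subtractf)
    also have "(\<Sum>c\<in>idx_set m n. x (f a) c * X c (g b)) = (\<Sum>c\<in>idx_set p q. x (f a) (f c) * X (f c) (g b))"
      using x fa by (intro sum_over_A) (simp add: block_diagonal_zero)
    also have "(\<Sum>c\<in>idx_set m n. (-1) ^ ((par a + par c) * (par c + par b)) * (X (f a) c * x c (g b)))
        = (\<Sum>d\<in>idx_set p' q'. ?s d * (X (f a) (g d) * x (g d) (g b)))"
      using x gb by (subst two_blocks.sum_over_A[OF swap_blocks]) (simp_all add: block_diagonal_zero)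
    also have "(\<Sum>c\<in>idx_set p q. x (f a) (f c) * X (f c) (g b)) - \<dots>
        = (\<Sum>c\<in>idx_set p q. x (f a) (f c) * nil_coords X (c, b))
        + (\<Sum>d\<in>idx_set p' q'. - ?s d * x (g d) (g b) * nil_coords X (a, d))"
      using True by (simp add: nil_coords_def sum_negf algebra_simps)
    also have "\<dots> = (\<Sum>(c, d)\<in>idx_set p q \<times> idx_set p' q'.
        ((if b = d then x (f a) (f c) else 0) + (if a = c then - ?s d * x (g d) (g b) else 0)) * nil_coords X (c, d))"
      using True by (intro sum_tensor_entries[symmetric]) auto
    also have "\<dots> = act (rep_module nil_rep) x (nil_coords X) (a, b)"
      using True
      by (auto simp: rep_module_def rep_tensor_def rep_pullback_def rep_dual_def std_rep_def
          submat_def sign intro!: sum.cong)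
    finally show ?thesis using True by (simp add: ab nil_coords_def)
  qed
qed

lemma nil_coords_bij:
  "bij_betw nil_coords {X. \<forall>a b. X a b \<noteq> 0 \<longrightarrow> a \<in> A \<and> b \<in> B}
     {v. \<forall>a. v a \<noteq> 0 \<longrightarrow> a \<in> idx_set p q \<times> idx_set p' q'}"
proof (rule bij_betw_byWitness[where f' = "\<lambda>v a b. if a \<in> A \<and> b \<in> B
    then v (inv_into (idx_set p q) f a, inv_into (idx_set p' q') g b) else 0"])
  have 1: "f (inv_into (idx_set p q) f a) = a" "inv_into (idx_set p q) f a \<in> idx_set p q" if "a \<in> A" for a
    using f that by (auto simp: bij_betw_def f_inv_into_f inv_into_into)
  have 2: "g (inv_into (idx_set p' q') g a) = a" "inv_into (idx_set p' q') g a \<in> idx_set p' q'" if "a \<in> B" for a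
    using g that by (auto simp: bij_betw_def f_inv_into_f inv_into_into)
  have 3: "inv_into (idx_set p q) f (f a) = a" if "a \<in> idx_set p q" for a
    using f that by (simp add: bij_betw_def)
  have 4: "inv_into (idx_set p' q') g (g a) = a" if "a \<in> idx_set p' q'" for a
    using g that by (simp add: bij_betw_def)
  show "\<forall>X\<in>{X. \<forall>a b. X a b \<noteq> 0 \<longrightarrow> a \<in> A \<and> b \<in> B}. (\<lambda>a b. if a \<in> A \<and> b \<in> B
      then nil_coords X (inv_into (idx_set p q) f a, inv_into (idx_set p' q') g b) else 0) = X"
    by (auto simp: fun_eq_iff nil_coords_def 1 2)
  show "\<forall>v\<in>{v. \<forall>a. v a \<noteq> 0 \<longrightarrow> a \<in> idx_set p q \<times> idx_set p' q'}. nil_coords (\<lambda>a b. if a \<in> A \<and> b \<in> B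
      then v (inv_into (idx_set p q) f a, inv_into (idx_set p' q') g b) else 0) = v"
    using f_in g_in by (auto simp: fun_eq_iff nil_coords_def 3 4)
  show "nil_coords ` {X. \<forall>a b. X a b \<noteq> 0 \<longrightarrow> a \<in> A \<and> b \<in> B}
      \<subseteq> {v. \<forall>a. v a \<noteq> 0 \<longrightarrow> a \<in> idx_set p q \<times> idx_set p' q'}"
    by (auto simp: nil_coords_def split: if_splits)
  show "(\<lambda>v a b. if a \<in> A \<and> b \<in> B
      then v (inv_into (idx_set p q) f a, inv_into (idx_set p' q') g b) else 0) `
      {v. \<forall>a. v a \<noteq> 0 \<longrightarrow> a \<in> idx_set p q \<times> idx_set p' q'}
      \<subseteq> {X. \<forall>a b. X a b \<noteq> 0 \<longrightarrow> a \<in> A \<and> b \<in> B}"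
    by (auto split: if_splits)
qed

lemma nil_coords_parity:
  assumes X: "\<forall>a b. X a b \<noteq> 0 \<longrightarrow> a \<in> A \<and> b \<in> B"
  shows "homogeneous_mat k X \<longleftrightarrow> (\<forall>a b. nil_coords X (a, b) \<noteq> 0 \<longrightarrow> (even (par a + par b) \<longleftrightarrow> even k))"
proof
  assume "homogeneous_mat k X"
  then have "even (par a + par b) \<longleftrightarrow> even k" if "X a b \<noteq> 0" for a b
    using that unfolding homogeneous_mat_def by blast
  from this[of "f _" "g _"]
  show "\<forall>a b. nil_coords X (a, b) \<noteq> 0 \<longrightarrow> (even (par a + par b) \<longleftrightarrow> even k)"
    by (simp add: nil_coords_def)
next
  assume *: "\<forall>a b. nil_coords X (a, b) \<noteq> 0 \<longrightarrow> (even (par a + par b) \<longleftrightarrow> even k)"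
  show "homogeneous_mat k X"
    unfolding homogeneous_mat_def
  proof (intro allI impI)
    fix a b assume ab: "X a b \<noteq> 0"
    then obtain c d where cd: "a = f c" "b = g d" "c \<in> idx_set p q" "d \<in> idx_set p' q'"
      using X f g by (force simp: bij_betw_def)
    then have "nil_coords X (c, d) \<noteq> 0" using ab by (simp add: nil_coords_def)
    then show "even (par a + par b) \<longleftrightarrow> even k" using * cd by auto
  qed
qed

lemma nilradical_module_iso:
  assumes mn: "m \<noteq> n"
  shows "module_iso (levi_subalgebra m n (block_parabolic m n A))
    (nilradical_module m n (block_parabolic m n A)) (rep_module nil_rep) nil_coords"
proof -
  let ?N = "{X. \<forall>a b. X a b \<noteq> 0 \<longrightarrow> a \<in> A \<and> b \<in> B}"
  have N: "nilradical m n (block_parabolic m n A) = ?N"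
    using nilradical_block[OF mn] by blast
  have L: "lspace (lsa_restrict (gl m n) levi_space) = levi_space" by simp
  have "mspace (rep_module nil_rep) = {v. \<forall>a. v a \<noteq> 0 \<longrightarrow> a \<in> idx_set p q \<times> idx_set p' q'}"
    by (simp add: rep_module_def rep_tensor_def rep_pullback_def rep_dual_def std_rep_def)
  then have "bij_betw nil_coords (mspace (nilradical_module m n (block_parabolic m n A))) (mspace (rep_module nil_rep))"
    using nil_coords_bij by (simp add: nilradical_module_def N)
  moreover have "nil_coords X \<in> meven (rep_module nil_rep) \<longleftrightarrow> homogeneous_mat 0 X" if "X \<in> ?N" for X
    using nil_coords_parity[of X 0] that
    by (simp add: rep_module_def rep_tensor_def rep_pullback_def rep_dual_def std_rep_def split_paired_All)
  moreover have "nil_coords X \<in> modd (rep_module nil_rep) \<longleftrightarrow> homogeneous_mat 1 X" if "X \<in> ?N" for X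
    using nil_coords_parity[of X 1] that
    by (simp add: rep_module_def rep_tensor_def rep_pullback_def rep_dual_def std_rep_def split_paired_All)
  moreover have "nil_coords (mat_scale c X) = mscale (rep_module nil_rep) c (nil_coords X)" for c X
    by (auto simp: nil_coords_def mat_scale_def rep_module_def)
  moreover have "nil_coords (X + Y) = nil_coords X + nil_coords Y" for X Y
    by (auto simp: nil_coords_def fun_eq_iff)
  moreover have "nil_coords (sbracket m n x X) = act (rep_module nil_rep) x (nil_coords X)"
    if "x \<in> levi_space" "X \<in> ?N" for x X
    using sbracket_nil that by (simp add: levi_space_def)
  ultimately show ?thesis
    by (simp add: module_iso_def nilradical_module_def N levi_eq[OF mn])
qed

end

lemma rep_pullback_pullback: "rep_pullback h (rep_pullback k R) = rep_pullback (\<lambda>x. k (h x)) R"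
  by (simp add: rep_pullback_def)

lemma rep_pullback_tensor:
  "rep_pullback h (rep_tensor R S) = rep_tensor (rep_pullback h R) (rep_pullback h S)"
  by (auto simp: rep_pullback_def rep_tensor_def fun_eq_iff)

lemma rep_pullback_dual: "rep_pullback h (rep_dual R) = rep_dual (rep_pullback h R)"
  by (simp add: rep_pullback_def rep_dual_def)

section \<open>Blocks cut out by a Weyl group element, and the classification\<close>

lemma bij_betw_shift:
  "bij_betw (map_sum ((+) r) ((+) s)) (idx_set p q) (idx_set (r + p) (s + q) - idx_set r s)"
proof (rule bij_betwI[where g = "map_sum (\<lambda>i. i - r) (\<lambda>k. k - s)"])
  show "map_sum ((+) r) ((+) s) \<in> idx_set p q \<rightarrow> idx_set (r + p) (s + q) - idx_set r s"
    by (auto simp: idx_set_def)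
qed (auto simp: idx_set_def, arith+)

lemma weyl_two_blocks:
  assumes adm: "admissible m n m0 n0" and w: "w \<in> weyl_group m n"
    and A: "A \<subseteq> idx_set m n" "weyl_perm w ` A = idx_set m0 n0"
  shows "two_blocks m n m0 n0 (m - m0) (n - n0) A (idx_set m n - A)
    (inv (weyl_perm w) \<circ> map_sum ((+) 0) ((+) 0)) (inv (weyl_perm w) \<circ> map_sum ((+) m0) ((+) n0))"
proof -
  note perm = weyl_perm_permutes[OF w]
  have bij: "bij (inv (weyl_perm w))" using permutes_bij[OF permutes_inv[OF perm]] .
  have inv_A: "inv (weyl_perm w) ` idx_set m0 n0 = A"
    using A(2) by (metis bij_betw_imp_inj_on image_inv_f_f permutes_bij[OF perm])
  have inv_B: "inv (weyl_perm w) ` (idx_set m n - idx_set m0 n0) = idx_set m n - A"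
    using image_set_diff[OF bij_is_inj[OF bij]] inv_A permutes_image[OF permutes_inv[OF perm]] by metis
  have le: "m0 + (m - m0) = m" "n0 + (n - n0) = n" using adm by (auto simp: admissible_def)
  have "idx_set 0 0 = {}" by (simp add: idx_set_def)
  then have 1: "bij_betw (map_sum ((+) 0) ((+) 0)) (idx_set m0 n0) (idx_set m0 n0)"
    using bij_betw_shift[of 0 0 m0 n0] by simp
  have 2: "bij_betw (map_sum ((+) m0) ((+) n0)) (idx_set (m - m0) (n - n0)) (idx_set m n - idx_set m0 n0)"
    using bij_betw_shift[of m0 n0 "m - m0" "n - n0"] by (simp add: le)
  have par_inv: "par (inv (weyl_perm w) a) = par a" for a
    by (metis par_weyl_perm permutes_inverses(1)[OF perm])
  have par_shift: "par (map_sum h k a) = par a" for h k a by (cases a) simp_all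
  show ?thesis
  proof
    show "bij_betw (inv (weyl_perm w) \<circ> map_sum ((+) 0) ((+) 0)) (idx_set m0 n0) A"
      using bij_betw_trans[OF 1] bij inv_A by (metis bij_betw_subset subset_UNIV)
    show "bij_betw (inv (weyl_perm w) \<circ> map_sum ((+) m0) ((+) n0)) (idx_set (m - m0) (n - n0)) (idx_set m n - A)"
      using bij_betw_trans[OF 2] bij inv_B by (metis bij_betw_subset subset_UNIV)
  qed (use A(1) in \<open>auto simp: par_inv par_shift\<close>)
qed

theorem theorem2p1:
  fixes m n :: nat and P :: "weight set"
  assumes "m \<noteq> n" and "parabolic_set m n P" and "cominuscule m n P"
  shows
    "(\<exists>!p. case p of (m0, n0) \<Rightarrow>
        admissible m n m0 n0 \<and>
        (\<exists>w\<in>weyl_group m n. weyl_act w ` P = std_parabolic m n m0 n0)) \<and>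
     (\<forall>m0 n0. \<forall>w\<in>weyl_group m n.
        admissible m n m0 n0 \<and> weyl_act w ` P = std_parabolic m n m0 n0 \<longrightarrow>
        (m0 \<noteq> n0 \<and> m - m0 \<noteq> n - n0 \<longrightarrow>
          lsa_isomorphic (levi_subalgebra m n P)
            (lsa_sum (lsa_sum (sl m0 n0) (sl (m - m0) (n - n0))) lsa_C)) \<and>
        (\<exists>S T. semidirect_sum (levi_subalgebra m n P) S T \<and>
          lsa_isomorphic (lsa_restrict (levi_subalgebra m n P) S)
            (lsa_sum (sl m0 n0) (sl (m - m0) (n - n0))) \<and>
          lsa_isomorphic (lsa_restrict (levi_subalgebra m n P) T) lsa_C) \<and>
        module_isomorphic (levi_subalgebra m n P)
          (nilradical_module m n P) (nil_model m n m0 n0 w))"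
proof -
  obtain A where A: "A \<subseteq> idx_set m n" "A \<noteq> {}" "A \<noteq> idx_set m n" and P: "P = block_parabolic m n A"
    using cominuscule_two_classes[OF assms] .
  show ?thesis
  proof (intro conjI allI ballI impI)
    show "\<exists>!p. case p of (m0, n0) \<Rightarrow> admissible m n m0 n0 \<and>
        (\<exists>w\<in>weyl_group m n. weyl_act w ` P = std_parabolic m n m0 n0)"
      unfolding P by (rule unique_standard_conjugate[OF assms(1) A])
  next
    fix m0 n0 w
    assume w: "w \<in> weyl_group m n"
      and std: "admissible m n m0 n0 \<and> weyl_act w ` P = std_parabolic m n m0 n0"
    have adm: "admissible m n m0 n0" using std by blast
    have "A \<subset> idx_set m n" using A by blast
    from weyl_act_block_std_iff[OF assms(1) this w adm] have wA: "weyl_perm w ` A = idx_set m0 n0"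
      using std by (simp add: P)
    interpret two_blocks m n m0 n0 "m - m0" "n - n0" A "idx_set m n - A"
      "inv (weyl_perm w) \<circ> map_sum ((+) 0) ((+) 0)" "inv (weyl_perm w) \<circ> map_sum ((+) m0) ((+) n0)"
      using weyl_two_blocks[OF adm w A(1) wA] .
    show "lsa_isomorphic (levi_subalgebra m n P)
        (lsa_sum (lsa_sum (sl m0 n0) (sl (m - m0) (n - n0))) lsa_C)"
      if "m0 \<noteq> n0 \<and> m - m0 \<noteq> n - n0"
      unfolding P using levi_direct_sum assms(1) that by blast
    show "\<exists>S T. semidirect_sum (levi_subalgebra m n P) S T \<and>
        lsa_isomorphic (lsa_restrict (levi_subalgebra m n P) S)
          (lsa_sum (sl m0 n0) (sl (m - m0) (n - n0))) \<and>
        lsa_isomorphic (lsa_restrict (levi_subalgebra m n P) T) lsa_C"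
      unfolding P using levi_semidirect_sum assms(1) A by blast
    have "nil_model m n m0 n0 w = rep_module nil_rep"
      unfolding nil_model_def
      by (simp add: rep_pullback_tensor rep_pullback_dual rep_pullback_pullback diag_block_weyl_conj)
    then show "module_isomorphic (levi_subalgebra m n P) (nilradical_module m n P) (nil_model m n m0 n0 w)"
      unfolding P module_isomorphic_def using nilradical_module_iso[OF assms(1)] by metis
  qed
qed

end
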